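(* Let $G$ be a connected graph with $n(G)\ge 5$ vertices and clique number $\omega(G)\le n(G)-3$. Then $\dim_l(G)\le n(G)-3$. Moreover, equality $\dim_l(G)=n(G)-3$ holds if and only if $G$ is isomorphic to the cycle $C_5$ or to $K_{n(G)}^{-}(\lambda,\mu)$ for some integers $\lambda\ge\mu\ge 2$ with $\lambda+\mu<n(G)$.
   Context: All graphs are finite and simple. $n(G)$ is the number of vertices and $\omega(G)$ the clique number of $G$. For vertices $x,y$ of a connected graph $G$, $d_G(x,y)$ is the length of a shortest $x,y$-path. A vertex $w$ distinguishes vertices $u,v$ if $d_G(u,w)\neq d_G(v,w)$. A set $W\subseteq V(G)$ is a local resolving set of $G$ if for every pair of adjacent vertices $u,v\in V(G)\setminus W$ some vertex of $W$ distinguishes $u$ and $v$. The local metric dimension $\dim_l(G)$ is the minimum cardinality of a local resolving set of $G$. For $n\ge 3$ and $1\le\mu\le\lambda$ with $\lambda+\mu\le n-1$, $K_n^{-}(\lambda,\mu)$ denotes the graph obtained from $K_n$ by deleting all edges of a subgraph isomorphic to $K_{\lambda,\mu}$ (well defined up to isomorphism). *)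

theory Defs
  imports Main
begin

definition simple_graph :: "'a set \<Rightarrow> ('a \<Rightarrow> 'a \<Rightarrow> bool) \<Rightarrow> bool" where
  "simple_graph V E \<longleftrightarrow> finite V \<and> (\<forall>x y. E x y \<longrightarrow> x \<in> V \<and> y \<in> V)
      \<and> (\<forall>x y. E x y \<longrightarrow> E y x) \<and> (\<forall>x. \<not> E x x)"

definition is_walk :: "'a set \<Rightarrow> ('a \<Rightarrow> 'a \<Rightarrow> bool) \<Rightarrow> 'a list \<Rightarrow> bool" where
  "is_walk V E xs \<longleftrightarrow> xs \<noteq> [] \<and> set xs \<subseteq> V \<and> (\<forall>i. Suc i < length xs \<longrightarrow> E (xs ! i) (xs ! Suc i))"

definition connected_graph :: "'a set \<Rightarrow> ('a \<Rightarrow> 'a \<Rightarrow> bool) \<Rightarrow> bool" where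
  "connected_graph V E \<longleftrightarrow> V \<noteq> {} \<and>
     (\<forall>x\<in>V. \<forall>y\<in>V. \<exists>xs. is_walk V E xs \<and> hd xs = x \<and> last xs = y)"

definition gdist :: "'a set \<Rightarrow> ('a \<Rightarrow> 'a \<Rightarrow> bool) \<Rightarrow> 'a \<Rightarrow> 'a \<Rightarrow> nat" where
  "gdist V E x y = (LEAST k. \<exists>xs. is_walk V E xs \<and> hd xs = x \<and> last xs = y \<and> length xs = Suc k)"

definition is_clique :: "'a set \<Rightarrow> ('a \<Rightarrow> 'a \<Rightarrow> bool) \<Rightarrow> 'a set \<Rightarrow> bool" where
  "is_clique V E K \<longleftrightarrow> K \<subseteq> V \<and> (\<forall>x\<in>K. \<forall>y\<in>K. x \<noteq> y \<longrightarrow> E x y)"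

definition clique_number :: "'a set \<Rightarrow> ('a \<Rightarrow> 'a \<Rightarrow> bool) \<Rightarrow> nat" where
  "clique_number V E = Max {card K | K. is_clique V E K}"

definition local_resolving_set :: "'a set \<Rightarrow> ('a \<Rightarrow> 'a \<Rightarrow> bool) \<Rightarrow> 'a set \<Rightarrow> bool" where
  "local_resolving_set V E W \<longleftrightarrow> W \<subseteq> V \<and>
     (\<forall>u\<in>V - W. \<forall>v\<in>V - W. E u v \<longrightarrow> (\<exists>w\<in>W. gdist V E u w \<noteq> gdist V E v w))"

definition local_metric_dim :: "'a set \<Rightarrow> ('a \<Rightarrow> 'a \<Rightarrow> bool) \<Rightarrow> nat" where
  "local_metric_dim V E = Min {card W | W. local_resolving_set V E W}"

definition graph_iso :: "'a set \<Rightarrow> ('a \<Rightarrow> 'a \<Rightarrow> bool) \<Rightarrow> 'b set \<Rightarrow> ('b \<Rightarrow> 'b \<Rightarrow> bool) \<Rightarrow> bool" where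
  "graph_iso V E V' E' \<longleftrightarrow> (\<exists>f. bij_betw f V V' \<and> (\<forall>x\<in>V. \<forall>y\<in>V. E x y \<longleftrightarrow> E' (f x) (f y)))"

definition C5_V :: "nat set" where "C5_V = {0..<5}"
definition C5_E :: "nat \<Rightarrow> nat \<Rightarrow> bool" where
  "C5_E i j \<longleftrightarrow> i < 5 \<and> j < 5 \<and> (j = Suc i mod 5 \<or> i = Suc j mod 5)"

text \<open>K_n minus the edges of a K_{l,m} with parts {0..<l} and {l..<l+m}.\<close>
definition Kminus_V :: "nat \<Rightarrow> nat set" where "Kminus_V n = {0..<n}"
definition Kminus_E :: "nat \<Rightarrow> nat \<Rightarrow> nat \<Rightarrow> nat \<Rightarrow> nat \<Rightarrow> bool" where
  "Kminus_E n l m i j \<longleftrightarrow> i < n \<and> j < n \<and> i \<noteq> j \<and>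
     \<not> ((i < l \<and> l \<le> j \<and> j < l + m) \<or> (j < l \<and> l \<le> i \<and> i < l + m))"

end

theory Submission
  imports Defs
begin

text \<open>
  Call a graph good if some four vertices can be left out such that any two adjacent ones among them
  are told apart by adjacency to a remaining vertex; then the local metric dimension is at most
  \<open>n - 4\<close>. A connected graph with \<open>n \<ge> 5\<close> and \<open>\<omega> \<le> n - 3\<close> is good, a five-cycle, a
  \<open>K\<^sub>n\<^sup>-(\<lambda>, \<mu>)\<close>, or a path on four vertices blown up to cliques in which an inner clique is a
  single vertex. If \<open>\<omega> \<le> n - 4\<close>, this follows by induction on deleting a non-cut vertex. If
  \<open>\<omega> = n - 3\<close>, let \<open>K\<close> be a maximum clique and \<open>a, b, c\<close> the other vertices. Leaving out
  \<open>a, b, c\<close> and one vertex of \<open>K\<close> works unless the graph is a five-cycle or two adjacent vertices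
  among \<open>a, b, c\<close> have the same neighbours in \<open>K\<close>; the latter case depends only on two subsets of \<open>K\<close>.

  The blown-up path still has dimension at most \<open>n - 4\<close>, by comparing distances 2 and 3. In
  \<open>K\<^sub>n\<^sup>-(\<lambda>, \<mu>)\<close> the three classes consist of true twins, so a local resolving set misses
  at most one vertex of each.
\<close>

section \<open>Levels of a labelling and the choice of elements from small sets\<close>

definition level :: "'a set \<Rightarrow> ('a \<Rightarrow> nat) \<Rightarrow> nat \<Rightarrow> 'a set" where
  "level V l i = {x \<in> V. l x = i}"

lemma other_element:
  assumes "2 \<le> card B"
  obtains y where "y \<in> B" "y \<noteq> x"
proof -
  have "\<not> B \<subseteq> {x}"
    using card_mono[of "{x}" B] assms by auto
  then show ?thesis using that by blast
qed

lemma two_elements: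
  assumes "2 \<le> card B"
  obtains x y where "x \<in> B" "y \<in> B" "x \<noteq> y"
  using other_element[OF assms] by metis

lemma singleton_if_small:
  assumes "finite B" "a \<in> B" "\<not> 2 \<le> card B"
  shows "B = {a}"
proof -
  have "card B \<noteq> 0" using assms by auto
  then have "card B = 1" using assms(3) by linarith
  then show ?thesis using assms(2) by (metis card_1_singletonE singletonD)
qed

lemma level_insert:
  "v \<notin> V \<Longrightarrow> level (insert v V) (l(v := k)) i = (if i = k then insert v (level V l i) else level V l i)"
  by (auto simp: level_def)

lemma two_others:
  assumes "3 \<le> card B"
  obtains y z where "y \<in> B" "z \<in> B" "y \<noteq> x" "z \<noteq> x" "y \<noteq> z"
proof -
  have "2 \<le> card (B - {x})"
    using assms by (cases "x \<in> B") (simp_all add: card_Diff_singleton_if)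
  then obtain y z where "y \<in> B - {x}" "z \<in> B - {x}" "y \<noteq> z" by (rule two_elements)
  then show ?thesis by (intro that[of y z]) auto
qed

lemma third_element:
  assumes "3 \<le> card B"
  obtains z where "z \<in> B" "z \<noteq> x" "z \<noteq> y"
proof -
  obtain z w where "z \<in> B" "w \<in> B" "z \<noteq> x" "w \<noteq> x" "z \<noteq> w" using assms by (rule two_others)
  then show ?thesis by (cases "z = y") (auto intro: that)
qed

section \<open>Clique blow-ups of paths and their one-vertex extensions\<close>

locale adjacency =
  fixes E :: "'a \<Rightarrow> 'a \<Rightarrow> bool"
  assumes sym: "E x y \<Longrightarrow> E y x" and irrefl: "\<not> E x x"
begin

lemma sym_iff: "E x y \<longleftrightarrow> E y x"
  using sym by blast

text \<open>Separation by adjacency alone: unlike separation by distance it is inherited by every larger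
  vertex set, which makes induction on induced subgraphs possible.\<close>

definition good :: "'a set \<Rightarrow> bool" where
  "good V \<longleftrightarrow> (\<exists>S\<subseteq>V. card S = 4 \<and>
     (\<forall>x\<in>S. \<forall>y\<in>S. E x y \<longrightarrow> (\<exists>w\<in>V - S. E x w \<noteq> E y w)))"

text \<open>Connectedness of the induced subgraph in cut form. No walks occur, so vertices can be
  added and deleted without following paths.\<close>

definition linked :: "'a set \<Rightarrow> bool" where
  "linked V \<longleftrightarrow> (\<forall>A. A \<subseteq> V \<and> A \<noteq> {} \<and> A \<noteq> V \<longrightarrow> (\<exists>x\<in>A. \<exists>y\<in>V - A. E x y))"

definition five_cycle :: "'a set \<Rightarrow> 'a \<Rightarrow> 'a \<Rightarrow> 'a \<Rightarrow> 'a \<Rightarrow> 'a \<Rightarrow> bool" where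
  "five_cycle V p q r s t \<longleftrightarrow> V = {p, q, r, s, t} \<and> distinct [p, q, r, s, t] \<and>
     E p q \<and> E q r \<and> E r s \<and> E s t \<and> E t p \<and>
     \<not> E p r \<and> \<not> E p s \<and> \<not> E q s \<and> \<not> E q t \<and> \<not> E r t"

text \<open>A chain is a path whose vertices are blown up to cliques, the levels. With three levels it is the
  graph \<open>K\<^sub>n\<^sup>-(\<lambda>, \<mu>)\<close> whose deleted edges join the outer levels.\<close>

definition chain :: "'a set \<Rightarrow> ('a \<Rightarrow> nat) \<Rightarrow> bool" where
  "chain V l \<longleftrightarrow> (\<forall>x\<in>V. \<forall>y\<in>V. x \<noteq> y \<longrightarrow> (E x y \<longleftrightarrow> l x \<le> Suc (l y) \<and> l y \<le> Suc (l x)))"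

text \<open>A largest clique consists of the middle level and the larger outer level. The bound
  \<open>n - 3\<close> on the clique number therefore forces at least three vertices on each outer
  level.\<close>

definition three_chain :: "'a set \<Rightarrow> ('a \<Rightarrow> nat) \<Rightarrow> bool" where
  "three_chain V l \<longleftrightarrow> chain V l \<and> (\<forall>x\<in>V. l x \<le> 2) \<and> level V l 1 \<noteq> {} \<and>
     3 \<le> card (level V l 0) \<and> 3 \<le> card (level V l 2)"

text \<open>With a single vertex on level 2, no adjacency to another vertex separates level 0 from level 1;
  distances to level 3 do.\<close>

definition four_chain :: "'a set \<Rightarrow> ('a \<Rightarrow> nat) \<Rightarrow> bool" where
  "four_chain V l \<longleftrightarrow> chain V l \<and> (\<forall>x\<in>V. l x \<le> 3) \<and> level V l 0 \<noteq> {} \<and> level V l 1 \<noteq> {} \<and>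
     (\<exists>c. level V l 2 = {c}) \<and> 2 \<le> card (level V l 3) \<and>
     3 \<le> card (level V l 0) + card (level V l 1)"

lemma chain_insert:
  assumes "chain V l" "v \<notin> V" "\<And>y. y \<in> V \<Longrightarrow> E v y \<longleftrightarrow> k \<le> Suc (l y) \<and> l y \<le> Suc k"
  shows "chain (insert v V) (l(v := k))"
  unfolding chain_def
proof (intro ballI impI)
  fix x y assume xy: "x \<in> insert v V" "y \<in> insert v V" "x \<noteq> y"
  show "E x y \<longleftrightarrow> (l(v := k)) x \<le> Suc ((l(v := k)) y) \<and> (l(v := k)) y \<le> Suc ((l(v := k)) x)"
    using xy assms(1) assms(3)[of x] assms(3)[of y] sym_iff[of x v] unfolding chain_def
    by (cases "x = v"; cases "y = v") (simp_all, blast)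
qed

lemma good_mono:
  assumes "good V" "V \<subseteq> V'"
  shows "good V'"
proof -
  obtain S where "S \<subseteq> V" "card S = 4" "\<forall>x\<in>S. \<forall>y\<in>S. E x y \<longrightarrow> (\<exists>w\<in>V - S. E x w \<noteq> E y w)"
    using assms(1) unfolding good_def by blast
  then have "S \<subseteq> V' \<and> card S = 4 \<and> (\<forall>x\<in>S. \<forall>y\<in>S. E x y \<longrightarrow> (\<exists>w\<in>V' - S. E x w \<noteq> E y w))"
    using assms(2) by blast
  then show ?thesis unfolding good_def by blast
qed

text \<open>By symmetry the six unordered pairs of the four-set suffice. Naming the separators
  \<open>W\<close> explicitly turns every application into a finite check.\<close>

lemma goodI:
  assumes "distinct [p, q, r, s]" "{p, q, r, s} \<union> W \<subseteq> V" "W \<inter> {p, q, r, s} = {}"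
    and "E p q \<longrightarrow> (\<exists>w\<in>W. E p w \<noteq> E q w)" "E p r \<longrightarrow> (\<exists>w\<in>W. E p w \<noteq> E r w)"
    and "E p s \<longrightarrow> (\<exists>w\<in>W. E p w \<noteq> E s w)" "E q r \<longrightarrow> (\<exists>w\<in>W. E q w \<noteq> E r w)"
    and "E q s \<longrightarrow> (\<exists>w\<in>W. E q w \<noteq> E s w)" "E r s \<longrightarrow> (\<exists>w\<in>W. E r w \<noteq> E s w)"
  shows "good V"
proof -
  have sep: "E x y \<longrightarrow> (\<exists>w\<in>V - {p, q, r, s}. E x w \<noteq> E y w)"
    if "E x y \<longrightarrow> (\<exists>w\<in>W. E x w \<noteq> E y w)" for x y
    using that assms(2,3) by blast
  have sep': "E y x \<longrightarrow> (\<exists>w\<in>V - {p, q, r, s}. E y w \<noteq> E x w)"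
    if "E x y \<longrightarrow> (\<exists>w\<in>W. E x w \<noteq> E y w)" for x y
    using sep[OF that] sym by blast
  have "E x y \<longrightarrow> (\<exists>w\<in>V - {p, q, r, s}. E x w \<noteq> E y w)" if "x \<in> {p, q, r, s}" "y \<in> {p, q, r, s}" for x y
    using that assms(4-9)[THEN sep] assms(4-9)[THEN sep'] irrefl
    by (elim insertE emptyE) (simp_all only: simp_thms)
  moreover have "card {p, q, r, s} = 4"
    using assms(1) by simp
  ultimately show ?thesis
    unfolding good_def using assms(2) by (intro exI[of _ "{p, q, r, s}"]) blast
qed

section \<open>Adding a vertex to a chain with four levels\<close>

text \<open>If \<open>v\<close> distinguishes two vertices of one level, a good four-set arises.
  Otherwise its neighbourhood is a pattern of four bits, read off at one vertex per level, and not
  all zero by connectedness. The patterns of levels 0, 1 and 3 prolong the labelling. All others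
  give a good set, except that the pattern of level 2 may instead make the reversed labelling a
  four-chain.\<close>

lemma four_chain_extend:
  assumes ch: "four_chain V l" and fin: "finite V" and v: "v \<notin> V" and lk: "linked (insert v V)"
  shows "good (insert v V) \<or> (\<exists>l. four_chain (insert v V) l)"
proof (rule ccontr)
  assume "\<not> ?thesis"
  then have ng: "\<not> good (insert v V)" and nc: "\<And>l. \<not> four_chain (insert v V) l"
    by blast+
  have chain: "chain V l" and l3: "\<And>x. x \<in> V \<Longrightarrow> l x \<le> 3"
    and cards: "2 \<le> card (level V l 3)" "3 \<le> card (level V l 0) + card (level V l 1)"
    using ch unfolding four_chain_def by blast+
  have adj [simp]: "E x y \<longleftrightarrow> l x \<le> Suc (l y) \<and> l y \<le> Suc (l x)" if "x \<in> V" "y \<in> V" "x \<noteq> y" for x y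
    using chain that unfolding chain_def by blast
  have ne [simp]: "(x = y) = False" if "l x \<noteq> l y" for x y
    using that by auto
  have vV [simp]: "x \<noteq> v" "v \<noteq> x" if "x \<in> V" for x
    using that v by auto
  obtain u where u [simp]: "u \<in> V" "l u = 0" using ch unfolding four_chain_def level_def by blast
  obtain a where a [simp]: "a \<in> V" "l a = 1" using ch unfolding four_chain_def level_def by blast
  obtain c where c: "level V l 2 = {c}" using ch unfolding four_chain_def by blast
  then have c' [simp]: "c \<in> V" "l c = 2" unfolding level_def by auto
  obtain b b' where b [simp]: "b \<in> V" "l b = 3" "b' \<in> V" "l b' = 3" "b \<noteq> b'" "b' \<noteq> b"
    using two_elements[OF cards(1)] unfolding level_def by blast
  \<comment> \<open>From here on, exhibiting a good four-set closes any goal.\<close>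
  note goodI' = notE[OF ng goodI]
  \<comment> \<open>Two vertices of one level that \<open>v\<close> tells apart are left out
    together with representatives of two further levels. The representative of the fourth level
    separates the other adjacent pairs. Level 2 has only one vertex.\<close>
  have hom: "E v x = E v y" if xy: "x \<in> V" "y \<in> V" "l x = l y" for x y
  proof (rule ccontr)
    assume d: "E v x \<noteq> E v y"
    then have n: "x \<noteq> y" by auto
    consider "l x = 0" | "l x = 1" | "l x = 2" | "l x = 3"
      using l3[OF xy(1)] by linarith
    then show False
    proof cases
      case 1
      show ?thesis
        by (rule goodI'[of x y c b "{a, v}"]) (use d n xy 1 in \<open>simp_all add: sym_iff[of _ v]\<close>)
    next
      case 2
      show ?thesis
        by (rule goodI'[of x y u b "{c, v}"]) (use d n xy 2 in \<open>simp_all add: sym_iff[of _ v]\<close>)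
    next
      case 3
      then have "x \<in> level V l 2" "y \<in> level V l 2" using xy by (simp_all add: level_def)
      then show ?thesis using n by (simp add: c)
    next
      case 4
      show ?thesis
        by (rule goodI'[of x y u a "{c, v}"]) (use d n xy 4 in \<open>simp_all add: sym_iff[of _ v]\<close>)
    qed
  qed
  have Ev: "E v y \<longleftrightarrow> (if l y = 0 then E v u else if l y = 1 then E v a else if l y = 2 then E v c else E v b)"
    if y: "y \<in> V" for y
  proof -
    consider "l y = 0" | "l y = 1" | "l y = 2" | "l y = 3"
      using l3[OF y] by linarith
    then show ?thesis
      by cases (use hom[OF y, of u] hom[OF y, of a] hom[OF y, of c] hom[OF y, of b] in simp_all)
  qed
  have nbr: "E v u \<or> E v a \<or> E v c \<or> E v b"
  proof -
    have "{v} \<noteq> insert v V" using c'(1) v by blast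
    then obtain y where "y \<in> V" "E v y"
      using lk[unfolded linked_def, rule_format, of "{v}"] by auto
    then show ?thesis using Ev[of y] by (simp split: if_splits)
  qed
  \<comment> \<open>The value 2 is excluded for \<open>k\<close>, since level 2 has to stay a single
    vertex.\<close>
  have extend: "four_chain (insert v V) (l(v := k))"
    if "k \<in> {0, 1, 3}" "\<And>y. y \<in> V \<Longrightarrow> E v y \<longleftrightarrow> k \<le> Suc (l y) \<and> l y \<le> Suc k" for k
  proof -
    have "card (level V l i) \<le> card (level (insert v V) (l(v := k)) i)" for i
      using fin v by (intro card_mono) (auto simp: level_def)
    from this[of 0] this[of 1] this[of 3]
    have k: "2 \<le> card (level (insert v V) (l(v := k)) 3)"
      "3 \<le> card (level (insert v V) (l(v := k)) 0) + card (level (insert v V) (l(v := k)) 1)"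
      using cards by linarith+
    have k2: "level (insert v V) (l(v := k)) 2 = {c}"
      using that(1) v c by (auto simp: level_insert)
    have "u \<in> level (insert v V) (l(v := k)) 0" "a \<in> level (insert v V) (l(v := k)) 1"
      by (simp_all add: level_def)
    then have k01: "level (insert v V) (l(v := k)) 0 \<noteq> {}" "level (insert v V) (l(v := k)) 1 \<noteq> {}"
      by blast+
    have "\<forall>x\<in>insert v V. (l(v := k)) x \<le> 3"
    proof
      fix x assume "x \<in> insert v V"
      then show "(l(v := k)) x \<le> 3"
        using l3[of x] that(1) by (cases "x = v") auto
    qed
    then show ?thesis
      unfolding four_chain_def
      by (intro conjI chain_insert[OF chain v that(2)] k k01 exI[of _ c] k2)
  qed
  have e0: "\<not> (E v u \<and> E v a \<and> \<not> E v c \<and> \<not> E v b)"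
  proof
    assume h: "E v u \<and> E v a \<and> \<not> E v c \<and> \<not> E v b"
    have "four_chain (insert v V) (l(v := 0))"
    proof (rule extend)
      show "E v y \<longleftrightarrow> 0 \<le> Suc (l y) \<and> l y \<le> Suc 0" if "y \<in> V" for y
        using Ev[OF that] l3[OF that] h by auto
    qed simp
    then show False using nc by blast
  qed
  have e1: "\<not> (E v u \<and> E v a \<and> E v c \<and> \<not> E v b)"
  proof
    assume h: "E v u \<and> E v a \<and> E v c \<and> \<not> E v b"
    have "four_chain (insert v V) (l(v := 1))"
    proof (rule extend)
      show "E v y \<longleftrightarrow> 1 \<le> Suc (l y) \<and> l y \<le> Suc 1" if "y \<in> V" for y
        using Ev[OF that] l3[OF that] h by auto
    qed simp
    then show False using nc by blast
  qed
  have e3: "\<not> (\<not> E v u \<and> \<not> E v a \<and> E v c \<and> E v b)"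
  proof
    assume h: "\<not> E v u \<and> \<not> E v a \<and> E v c \<and> E v b"
    have "four_chain (insert v V) (l(v := 3))"
    proof (rule extend)
      show "E v y \<longleftrightarrow> 3 \<le> Suc (l y) \<and> l y \<le> Suc 3" if "y \<in> V" for y
        using Ev[OF that] l3[OF that] h by auto
    qed simp
    then show False using nc by blast
  qed
  \<comment> \<open>A spare vertex on the two lowest levels serves as an additional separator. It is
    taken from level 1 when possible; otherwise the fact that level 1 is just \<open>{a}\<close> is
    recorded for the reversal at the end.\<close>
  obtain z where z [simp]: "z \<in> V" "z \<noteq> u" "z \<noteq> a" "u \<noteq> z" "a \<noteq> z" and lz: "l z = 0 \<and> level V l 1 = {a} \<or> l z = 1"
  proof (cases "2 \<le> card (level V l 1)")
    case True
    then obtain z where "z \<in> level V l 1" and za: "z \<noteq> a" by (rule other_element)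
    then have "z \<in> V" "l z = 1" unfolding level_def by blast+
    then show ?thesis by (intro that[of z]) (use za in simp_all)
  next
    case False
    have fin1: "finite (level V l 1)" and a1: "a \<in> level V l 1"
      using fin by (simp_all add: level_def)
    have "level V l 1 = {a}"
      using a1 False fin1 by (intro singleton_if_small) auto
    note l1 = this
    have "2 \<le> card (level V l 0)"
      using cards(2) False by linarith
    then obtain z where "z \<in> level V l 0" and zu: "z \<noteq> u" by (rule other_element)
    then have "z \<in> V" "l z = 0" unfolding level_def by blast+
    then show ?thesis by (intro that[of z]) (use zu l1 in simp_all)
  qed
  have zE [simp]: "E v z \<longleftrightarrow> (if l z = 0 then E v u else E v a)"
    using Ev[of z] lz by (simp split: if_splits)
  have b'E [simp]: "E v b' \<longleftrightarrow> E v b"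
    using Ev[of b'] by simp
  have z' [simp]: "z \<noteq> c" "z \<noteq> b" "z \<noteq> b'" "c \<noteq> z" "b \<noteq> z" "b' \<noteq> z"
    using lz c' b by auto
  \<comment> \<open>Three candidate four-sets containing \<open>v\<close>. Pairs avoiding
    \<open>v\<close> are settled by the levels, so only the conditions on pairs with
    \<open>v\<close> are kept and later evaluated on the patterns.\<close>
  have g1: "\<not> ((E v u \<longrightarrow> (\<exists>w\<in>{a, b', z}. E v w \<noteq> E u w)) \<and> (E v c \<longrightarrow> (\<exists>w\<in>{a, b', z}. E v w \<noteq> E c w)) \<and>
    (E v b \<longrightarrow> (\<exists>w\<in>{a, b', z}. E v w \<noteq> E b w)))"
    by (intro notI, elim conjE, rule goodI'[of v u c b "{a, b', z}"]) ((assumption | simp)+)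
  have g2: "\<not> ((E v u \<longrightarrow> (\<exists>w\<in>{c, b', z}. E v w \<noteq> E u w)) \<and> (E v a \<longrightarrow> (\<exists>w\<in>{c, b', z}. E v w \<noteq> E a w)) \<and>
    (E v b \<longrightarrow> (\<exists>w\<in>{c, b', z}. E v w \<noteq> E b w)))"
    by (intro notI, elim conjE, rule goodI'[of v u a b "{c, b', z}"]) ((assumption | simp)+)
  have g3: "l z = 1 \<Longrightarrow> \<not> ((E v a \<longrightarrow> (\<exists>w\<in>{u, b', z}. E v w \<noteq> E a w)) \<and> (E v b \<longrightarrow> (\<exists>w\<in>{u, b', z}. E v w \<noteq> E b w)) \<and>
    (E v c \<longrightarrow> (\<exists>w\<in>{u, b', z}. E v w \<noteq> E c w)))"
    by (intro notI, elim conjE, rule goodI'[of v a b c "{u, b', z}"]) ((assumption | simp)+)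
  show False
  proof (cases "l z = 1")
    case True
    then show ?thesis
      using nbr e0 e1 e3 g1[simplified] g2[simplified] g3[simplified] by (cases "E v u"; cases "E v a"; cases "E v c"; cases "E v b") simp_all
  next
    case False
    then have z0 [simp]: "l z = 0" and a1: "level V l 1 = {a}" using lz by auto
    \<comment> \<open>What survives is the pattern of level 2, which would place \<open>v\<close>
      beside \<open>c\<close>.\<close>
    have pat: "\<not> E v u \<and> E v a \<and> E v c \<and> E v b"
      using nbr e0 e1 e3 g1[simplified] g2[simplified] by (cases "E v u"; cases "E v a"; cases "E v c"; cases "E v b") simp_all
    have "card (level V l 1) = 1" using a1 by simp
    then have c0: "2 \<le> card (level V l 0)" using cards(2) by linarith
    \<comment> \<open>After reversal the single vertex \<open>a\<close> forms level 2, while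
      \<open>v\<close> and \<open>c\<close> share level 1. The old level 0 becomes level 3 and has
      two vertices because level 1 had only one.\<close>
    define m where "m = (\<lambda>x. 3 - l x)"
    have lev: "level V m i = level V l (3 - i)" if "i \<le> 3" for i
      using l3 that unfolding level_def m_def by force
    have "E x y \<longleftrightarrow> m x \<le> Suc (m y) \<and> m y \<le> Suc (m x)" if "x \<in> V" "y \<in> V" "x \<noteq> y" for x y
      using adj[OF that] l3[OF that(1)] l3[OF that(2)] unfolding m_def by auto
    then have "chain V m"
      unfolding chain_def by blast
    moreover have "E v y \<longleftrightarrow> 1 \<le> Suc (m y) \<and> m y \<le> Suc 1" if "y \<in> V" for y
      using Ev[OF that] l3[OF that] pat unfolding m_def by auto
    ultimately have ch': "chain (insert v V) (m(v := 1))"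
      by (rule chain_insert[OF _ v])
    have "(m(v := 1)) x \<le> 3" for x
      by (simp add: m_def)
    then have m3: "\<forall>x\<in>insert v V. (m(v := 1)) x \<le> 3"
      by blast
    have "level V m 1 = level V l 2" "level V m 2 = level V l 1"
      using lev[of 1] lev[of 2] by simp_all
    then have levm: "level V m 0 = level V l 3" "level V m 1 = {c}" "level V m 2 = {a}" "level V m 3 = level V l 0"
      using lev[of 0] lev[of 3] unfolding a1 c by simp_all
    have levs: "level (insert v V) (m(v := 1)) 0 = level V l 3"
      "level (insert v V) (m(v := 1)) 1 = {v, c}"
      "level (insert v V) (m(v := 1)) 2 = {a}"
      "level (insert v V) (m(v := 1)) 3 = level V l 0"
      unfolding level_insert[OF v] levm by simp_all
    have vc: "card {v, c} = 2"
      using v c'(1) by auto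
    have "b \<in> level V l 3" by (simp add: level_def)
    then have nonempty: "level V l 3 \<noteq> {}" by blast
    have "3 \<le> card (level V l 3) + 2" using cards(1) by linarith
    then have "four_chain (insert v V) (m(v := 1))"
      unfolding four_chain_def levs vc by (intro conjI exI[of _ a] nonempty ch' m3 insert_not_empty c0 refl)
    then show ?thesis using nc by blast
  qed
qed

section \<open>Adding a vertex to a chain with three levels\<close>

lemma three_chain_reverse:
  assumes "three_chain V l"
  shows "three_chain V (\<lambda>x. 2 - l x)"
proof -
  have l2: "\<And>x. x \<in> V \<Longrightarrow> l x \<le> 2" using assms unfolding three_chain_def by blast
  have lev: "level V (\<lambda>x. 2 - l x) i = level V l (2 - i)" if "i \<le> 2" for i
    using l2 that unfolding level_def by force
  have "chain V (\<lambda>x. 2 - l x)"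
    unfolding chain_def
  proof (intro ballI impI)
    fix x y assume xy: "x \<in> V" "y \<in> V" "x \<noteq> y"
    then have "E x y \<longleftrightarrow> l x \<le> Suc (l y) \<and> l y \<le> Suc (l x)"
      using assms unfolding three_chain_def chain_def by blast
    then show "E x y \<longleftrightarrow> 2 - l x \<le> Suc (2 - l y) \<and> 2 - l y \<le> Suc (2 - l x)"
      using l2[OF xy(1)] l2[OF xy(2)] by auto
  qed
  then show ?thesis
    using assms lev[of 0] lev[of 1] lev[of 2] unfolding three_chain_def by simp
qed

text \<open>The scheme is that of \<open>four_chain_extend\<close>: uniform behaviour on each level,
  then a finite list of patterns. A vertex that sees exactly level 0 becomes a new end of the chain.
  Seeing exactly level 2 is the mirror image and stays as the last alternative, to be removed by
  reversing the labelling.\<close>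

lemma three_chain_extend_aux:
  assumes ch: "three_chain V l" and fin: "finite V" and v: "v \<notin> V" and lk: "linked (insert v V)"
  shows "good (insert v V) \<or> (\<exists>l. three_chain (insert v V) l) \<or> (\<exists>l. four_chain (insert v V) l) \<or>
    (\<forall>y\<in>V. E v y \<longleftrightarrow> l y = 2)"
proof (rule ccontr)
  assume "\<not> ?thesis"
  then have ng: "\<not> good (insert v V)" and n3: "\<And>l. \<not> three_chain (insert v V) l"
    and n4: "\<And>l. \<not> four_chain (insert v V) l" and nb: "\<not> (\<forall>y\<in>V. E v y \<longleftrightarrow> l y = 2)"
    by blast+
  have chain: "chain V l" and l2: "\<And>x. x \<in> V \<Longrightarrow> l x \<le> 2"
    and cards: "3 \<le> card (level V l 0)" "3 \<le> card (level V l 2)"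
    using ch unfolding three_chain_def by blast+
  have adj [simp]: "E x y \<longleftrightarrow> l x \<le> Suc (l y) \<and> l y \<le> Suc (l x)" if "x \<in> V" "y \<in> V" "x \<noteq> y" for x y
    using chain that unfolding chain_def by blast
  have ne [simp]: "(x = y) = False" if "l x \<noteq> l y" for x y
    using that by auto
  have vV [simp]: "x \<noteq> v" "v \<noteq> x" if "x \<in> V" for x
    using that v by auto
  obtain c where c [simp]: "c \<in> V" "l c = 1" using ch unfolding three_chain_def level_def by blast
  have two: "2 \<le> card (level V l 0)" "2 \<le> card (level V l 2)" using cards by linarith+
  obtain a a' where a [simp]: "a \<in> V" "l a = 0" "a' \<in> V" "l a' = 0" "a \<noteq> a'" "a' \<noteq> a"
    using two_elements[OF two(1)] unfolding level_def by blast
  obtain b b' where b [simp]: "b \<in> V" "l b = 2" "b' \<in> V" "l b' = 2" "b \<noteq> b'" "b' \<noteq> b"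
    using two_elements[OF two(2)] unfolding level_def by blast
  note goodI' = notE[OF ng goodI]
  have hom: "E v x = E v y" if xy: "x \<in> V" "y \<in> V" "l x = l y" for x y
  proof (rule ccontr)
    assume d: "E v x \<noteq> E v y"
    then have n: "x \<noteq> y" by auto
    consider "l x = 0" | "l x = 1" | "l x = 2"
      using l2[OF xy(1)] by linarith
    then show False
    proof cases
      case 1
      obtain z where "z \<in> level V l 0" and z: "z \<noteq> x" "z \<noteq> y" by (rule third_element[OF cards(1)])
      then have z': "z \<in> V" "l z = 0" unfolding level_def by blast+
      show ?thesis
        by (rule goodI'[of x y c b "{z, b', v}"]) (use d n xy 1 z z' in \<open>simp_all add: sym_iff[of _ v]\<close>)
    next
      case 2
      show ?thesis
        by (rule goodI'[of x y a b "{a', b', v}"]) (use d n xy 2 in \<open>simp_all add: sym_iff[of _ v]\<close>)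
    next
      case 3
      obtain z where "z \<in> level V l 2" and z: "z \<noteq> x" "z \<noteq> y" by (rule third_element[OF cards(2)])
      then have z': "z \<in> V" "l z = 2" unfolding level_def by blast+
      show ?thesis
        by (rule goodI'[of x y c a "{z, a', v}"]) (use d n xy 3 z z' in \<open>simp_all add: sym_iff[of _ v]\<close>)
    qed
  qed
  have Ev: "E v y \<longleftrightarrow> (if l y = 0 then E v a else if l y = 1 then E v c else E v b)"
    if y: "y \<in> V" for y
  proof -
    consider "l y = 0" | "l y = 1" | "l y = 2"
      using l2[OF y] by linarith
    then show ?thesis
      by cases (use hom[OF y, of a] hom[OF y, of c] hom[OF y, of b] in simp_all)
  qed
  have nbr: "E v a \<or> E v c \<or> E v b"
  proof -
    have "{v} \<noteq> insert v V" using c(1) v by blast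
    then obtain y where "y \<in> V" "E v y"
      using lk[unfolded linked_def, rule_format, of "{v}"] by auto
    then show ?thesis using Ev[of y] by (simp split: if_splits)
  qed
  have extend: False
    if "k \<le> 2" "\<And>y. y \<in> V \<Longrightarrow> E v y \<longleftrightarrow> k \<le> Suc (l y) \<and> l y \<le> Suc k" for k
  proof -
    have "card (level V l i) \<le> card (level (insert v V) (l(v := k)) i)" for i
      using fin v by (intro card_mono) (auto simp: level_def)
    from this[of 0] this[of 2]
    have k: "3 \<le> card (level (insert v V) (l(v := k)) 0)" "3 \<le> card (level (insert v V) (l(v := k)) 2)"
      using cards by linarith+
    have "c \<in> level (insert v V) (l(v := k)) 1"
      by (simp add: level_def)
    then have k1: "level (insert v V) (l(v := k)) 1 \<noteq> {}"
      by blast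
    have "\<forall>x\<in>insert v V. (l(v := k)) x \<le> 2"
    proof
      fix x assume "x \<in> insert v V"
      then show "(l(v := k)) x \<le> 2"
        using l2[of x] that(1) by (cases "x = v") auto
    qed
    then have "three_chain (insert v V) (l(v := k))"
      unfolding three_chain_def
      by (intro conjI chain_insert[OF chain v that(2)] k k1)
    then show False using n3 by blast
  qed
  have e0: "\<not> (E v a \<and> E v c \<and> \<not> E v b)"
  proof
    assume h: "E v a \<and> E v c \<and> \<not> E v b"
    show False
    proof (rule extend[of 0])
      show "E v y \<longleftrightarrow> 0 \<le> Suc (l y) \<and> l y \<le> Suc 0" if "y \<in> V" for y
        using Ev[OF that] l2[OF that] h by auto
    qed simp
  qed
  have e1: "\<not> (E v a \<and> E v c \<and> E v b)"
  proof
    assume h: "E v a \<and> E v c \<and> E v b"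
    show False
    proof (rule extend[of 1])
      show "E v y \<longleftrightarrow> 1 \<le> Suc (l y) \<and> l y \<le> Suc 1" if "y \<in> V" for y
        using Ev[OF that] l2[OF that] h by auto
    qed simp
  qed
  have e2: "\<not> (\<not> E v a \<and> E v c \<and> E v b)"
  proof
    assume h: "\<not> E v a \<and> E v c \<and> E v b"
    show False
    proof (rule extend[of 2])
      show "E v y \<longleftrightarrow> 2 \<le> Suc (l y) \<and> l y \<le> Suc 2" if "y \<in> V" for y
        using Ev[OF that] l2[OF that] h by auto
    qed simp
  qed
  have nb': "\<not> (\<not> E v a \<and> \<not> E v c \<and> E v b)"
  proof
    assume h: "\<not> E v a \<and> \<not> E v c \<and> E v b"
    have "\<forall>y\<in>V. E v y \<longleftrightarrow> l y = 2"
    proof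
      fix y assume "y \<in> V"
      from Ev[OF this] l2[OF this] h show "E v y \<longleftrightarrow> l y = 2" by auto
    qed
    then show False using nb by blast
  qed
  have a'E [simp]: "E v a' \<longleftrightarrow> E v a" and b'E [simp]: "E v b' \<longleftrightarrow> E v b"
    using Ev[of a'] Ev[of b'] by simp_all
  have g1: "\<not> ((E v a \<longrightarrow> (\<exists>w\<in>{a', b'}. E v w \<noteq> E a w)) \<and> (E v b \<longrightarrow> (\<exists>w\<in>{a', b'}. E v w \<noteq> E b w)) \<and>
    (E v c \<longrightarrow> (\<exists>w\<in>{a', b'}. E v w \<noteq> E c w)))"
    by (intro notI, elim conjE, rule goodI'[of v a b c "{a', b'}"]) ((assumption | simp)+)
  have pat: "E v a \<and> \<not> E v c \<and> \<not> E v b"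
    using nbr e0 e1 e2 nb' g1[simplified] by (cases "E v a"; cases "E v c"; cases "E v b") simp_all
  \<comment> \<open>A second vertex \<open>d\<close> on level 1 would separate \<open>v\<close> from
    \<open>a\<close>, the one pair that \<open>a'\<close> and \<open>b'\<close> leave open.\<close>
  have c1: "level V l 1 = {c}"
  proof (rule ccontr)
    assume "level V l 1 \<noteq> {c}"
    then obtain d where "d \<in> level V l 1" "d \<noteq> c"
      using c unfolding level_def by blast
    then have d: "d \<in> V" "l d = 1" "d \<noteq> c" "c \<noteq> d" unfolding level_def by blast+
    show False
      by (rule goodI'[of v a b c "{a', b', d}"]) (use d pat Ev[OF d(1)] in simp_all)
  qed
  \<comment> \<open>All levels move up by one to make room for \<open>v\<close> on level 0; the
    single vertex \<open>c\<close> lands on level 2 as a four-chain demands.\<close>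
  define m where "m = (\<lambda>x. Suc (l x))"
  have lev: "level V m (Suc i) = level V l i" and lev0: "level V m 0 = {}" for i
    unfolding level_def m_def by simp_all
  have "chain V m"
    using chain unfolding chain_def m_def by simp
  moreover have "E v y \<longleftrightarrow> 0 \<le> Suc (m y) \<and> m y \<le> Suc 0" if "y \<in> V" for y
    using Ev[OF that] l2[OF that] pat unfolding m_def by auto
  ultimately have ch': "chain (insert v V) (m(v := 0))"
    by (rule chain_insert[OF _ v])
  have m3: "\<forall>x\<in>insert v V. (m(v := 0)) x \<le> 3"
  proof
    fix x assume "x \<in> insert v V"
    then show "(m(v := 0)) x \<le> 3"
      using l2[of x] unfolding m_def by (cases "x = v") auto
  qed
  have levm: "level V m 1 = level V l 0" "level V m 2 = {c}" "level V m 3 = level V l 2"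
    using lev[of 0] lev[of 1] lev[of 2] unfolding c1 by (simp_all add: numeral_eq_Suc)
  have levs: "level (insert v V) (m(v := 0)) 0 = {v}"
    "level (insert v V) (m(v := 0)) 1 = level V l 0"
    "level (insert v V) (m(v := 0)) 2 = {c}"
    "level (insert v V) (m(v := 0)) 3 = level V l 2"
    unfolding level_insert[OF v] levm lev0 by simp_all
  have "a \<in> level V l 0" by (simp add: level_def)
  then have nonempty: "level V l 0 \<noteq> {}" by blast
  have "3 \<le> card {v} + card (level V l 0)" using cards(1) by linarith
  then have "four_chain (insert v V) (m(v := 0))"
    unfolding four_chain_def levs by (intro conjI exI[of _ c] nonempty ch' m3 insert_not_empty two(2) refl)
  then show False using n4 by blast
qed

lemma three_chain_extend:
  assumes "three_chain V l" "finite V" "v \<notin> V" "linked (insert v V)"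
  shows "good (insert v V) \<or> (\<exists>l. three_chain (insert v V) l) \<or> (\<exists>l. four_chain (insert v V) l)"
proof -
  have "card (level V l 0) \<noteq> 0" using assms(1) unfolding three_chain_def by linarith
  then have "level V l 0 \<noteq> {}" by auto
  then obtain a where "a \<in> V" "l a = 0" unfolding level_def by blast
  \<comment> \<open>The open alternative cannot hold for the labelling and for its reverse: they
    disagree at \<open>a\<close>.\<close>
  then have "\<not> ((\<forall>y\<in>V. E v y \<longleftrightarrow> l y = 2) \<and> (\<forall>y\<in>V. E v y \<longleftrightarrow> 2 - l y = 2))"
    by (metis diff_zero zero_neq_numeral)
  then show ?thesis
    using three_chain_extend_aux[OF assms] three_chain_extend_aux[OF three_chain_reverse[OF assms(1)] assms(2-4)]
    by blast
qed

section \<open>Adding a vertex to a five-cycle\<close>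

lemma five_cycle_rotate: "five_cycle V p q r s t \<Longrightarrow> five_cycle V q r s t p"
  unfolding five_cycle_def using sym by auto

text \<open>On the induced path \<open>t, p, q, r\<close> the vertex \<open>s\<close> separates the
  ends of both outer edges and \<open>v\<close> those of the middle edge.\<close>

lemma five_cycle_split:
  assumes V: "five_cycle V p q r s t" and v: "v \<notin> V" and d: "E v p \<noteq> E v q"
  shows "good (insert v V)"
proof -
  have C: "V = {p, q, r, s, t}" "distinct [p, q, r, s, t]" and
    e: "E p q" "E q r" "E r s" "E s t" "E t p" "\<not> E p r" "\<not> E p s" "\<not> E q s" "\<not> E q t" "\<not> E r t"
    using V unfolding five_cycle_def by blast+
  have e': "E q p" "E r q" "E s r" "E t s" "E p t" "\<not> E r p" "\<not> E s p" "\<not> E s q" "\<not> E t q" "\<not> E t r"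
    using e sym by blast+
  have v': "v \<noteq> p" "v \<noteq> q" "v \<noteq> r" "v \<noteq> s" "v \<noteq> t" using v C(1) by blast+
  show ?thesis
    by (rule goodI[of t p q r "{v, s}"]) (use C e e' v' d in \<open>auto simp: sym_iff[of _ v]\<close>)
qed

text \<open>By rotating \<open>five_cycle_split\<close>, it remains to treat a vertex
  \<open>v\<close> that sees all of the cycle or nothing; connectedness leaves the former.\<close>

lemma five_cycle_extend:
  assumes V: "five_cycle V p q r s t" and v: "v \<notin> V" and lk: "linked (insert v V)"
  shows "good (insert v V)"
proof (rule ccontr)
  assume ng: "\<not> ?thesis"
  note r1 = five_cycle_rotate[OF V]
  note r2 = five_cycle_rotate[OF r1]
  note r3 = five_cycle_rotate[OF r2]
  have eq: "E v p = E v q" "E v q = E v r" "E v r = E v s" "E v s = E v t"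
    using five_cycle_split[OF _ v] V r1 r2 r3 ng by metis+
  have C: "V = {p, q, r, s, t}" "distinct [p, q, r, s, t]" and
    e: "E p q" "E q r" "E r s" "E s t" "E t p" "\<not> E p r" "\<not> E p s" "\<not> E q s" "\<not> E q t" "\<not> E r t"
    using V unfolding five_cycle_def by blast+
  have e': "E q p" "E r q" "E s r" "E t s" "E p t" "\<not> E r p" "\<not> E s p" "\<not> E s q" "\<not> E t q" "\<not> E t r"
    using e sym by blast+
  have v': "v \<noteq> p" "v \<noteq> q" "v \<noteq> r" "v \<noteq> s" "v \<noteq> t" using v C(1) by blast+
  have "{v} \<noteq> insert v V" using C(1) v by blast
  then obtain y where "y \<in> V" "E v y"
    using lk[unfolded linked_def, rule_format, of "{v}"] by auto
  then have all: "E v p" "E v q" "E v r" "E v s" "E v t"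
    using eq C(1) by auto
  \<comment> \<open>The traces on \<open>{p, q}\<close> are pairwise different: \<open>v\<close>
    sees both, \<open>r\<close> only \<open>q\<close>, \<open>s\<close> neither and \<open>t\<close>
    only \<open>p\<close>.\<close>
  have "good (insert v V)"
    by (rule goodI[of v r s t "{p, q}"]) (use C e e' v' all in auto)
  then show False using ng by blast
qed

section \<open>Classification\<close>

lemma linkedD:
  "linked V \<Longrightarrow> A \<subseteq> V \<Longrightarrow> A \<noteq> {} \<Longrightarrow> A \<noteq> V \<Longrightarrow> \<exists>x\<in>A. \<exists>y\<in>V - A. E x y"
  unfolding linked_def by (elim allE[of _ A]) simp

lemma linked_insert:
  assumes "linked C" "x \<in> C" "E x y"
  shows "linked (insert y C)"
proof (cases "y \<in> C")
  case True
  then show ?thesis using assms(1) by (simp add: insert_absorb)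
next
  case False
  show ?thesis
    unfolding linked_def
  proof (intro allI impI)
    fix A assume A: "A \<subseteq> insert y C \<and> A \<noteq> {} \<and> A \<noteq> insert y C"
    have inC: "\<exists>u\<in>B. \<exists>w\<in>C - B. E u w" if "B \<subseteq> C" "B \<noteq> {}" "B \<noteq> C" for B
      using assms(1) that unfolding linked_def by blast
    consider "A = {y}" | "A = C" | "A - {y} \<subseteq> C" "A - {y} \<noteq> {}" "A - {y} \<noteq> C"
      using A by blast
    then show "\<exists>u\<in>A. \<exists>w\<in>insert y C - A. E u w"
    proof cases
      case 1
      then show ?thesis using assms(2) False sym[OF assms(3)] by blast
    next
      case 2
      then show ?thesis using assms(2,3) False by blast
    next
      case 3
      from inC[OF this] show ?thesis using False by blast
    qed
  qed
qed

text \<open>Take an inclusion-maximal proper connected subset \<open>C\<close>. Some edge leaves it,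
  and adding the outer end keeps it connected, so by maximality \<open>C\<close> lacks just that
  vertex.\<close>

lemma linked_remove:
  assumes "linked V" "finite V" "2 \<le> card V"
  obtains v where "v \<in> V" "linked (V - {v})"
proof -
  let ?F = "{C. C \<subset> V \<and> C \<noteq> {} \<and> linked C}"
  obtain x y where xy: "x \<in> V" "y \<in> V" "x \<noteq> y" using assms(3) by (rule two_elements)
  have "linked {x}" unfolding linked_def by blast
  then have "{x} \<in> ?F" using xy by blast
  then have "?F \<noteq> {}" by blast
  moreover have "finite ?F" using assms(2) by (auto intro: finite_subset[of _ "Pow V"])
  ultimately have "\<exists>C\<in>?F. \<forall>D\<in>?F. C \<subseteq> D \<longrightarrow> C = D"
    by (intro finite_has_maximal)
  then obtain C where C': "C \<in> ?F" and max: "\<forall>D\<in>?F. C \<subseteq> D \<longrightarrow> C = D"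
    by (rule bexE)
  then have C: "C \<subset> V" "C \<noteq> {}" "linked C" by simp_all
  obtain u v where uv: "u \<in> C" "v \<in> V" "v \<notin> C" "E u v"
    using linkedD[OF assms(1), of C] C by blast
  have "linked (insert v C)" using C(3) uv(1,4) by (rule linked_insert)
  then have "insert v C \<in> ?F" if "insert v C \<noteq> V" using that uv(2) C(1) by blast
  then have "insert v C = V" using max uv(3) by blast
  then have "V - {v} = C" using uv(3) by blast
  then show ?thesis using that C(3) uv(2) by blast
qed

section \<open>A maximum clique that misses three vertices\<close>

text \<open>With \<open>P\<close> and \<open>Q\<close> the non-neighbours in \<open>K\<close> of
  \<open>a\<close> and of \<open>c\<close>, the graph is determined by \<open>P\<close>,
  \<open>Q\<close> and the adjacency of \<open>c\<close> to \<open>a\<close> and \<open>b\<close>.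
  The four-sets in \<open>gA\<close> and \<open>gB\<close> rule out all configurations but those in
  which \<open>K\<close> splits into at most two levels and the vertices \<open>a, b, c\<close>
  supply the others.\<close>

lemma clique_two_twins:
  assumes lk: "linked V" and fin: "finite V" and V: "V = K \<union> {a, b, c}"
    and abc: "a \<noteq> b" "a \<noteq> c" "b \<noteq> c" "a \<notin> K" "b \<notin> K" "c \<notin> K"
    and K: "\<And>x y. x \<in> K \<Longrightarrow> y \<in> K \<Longrightarrow> x \<noteq> y \<Longrightarrow> E x y"
    and max: "\<And>M. is_clique V E M \<Longrightarrow> card M \<le> card K"
    and ab: "E a b" and twins: "\<And>x. x \<in> K \<Longrightarrow> E a x = E b x"
  shows "good V \<or> (\<exists>l. three_chain V l) \<or> (\<exists>l. four_chain V l)"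
proof (rule ccontr)
  assume "\<not> ?thesis"
  then have ng: "\<not> good V" and n3: "\<And>l. \<not> three_chain V l" and n4: "\<And>l. \<not> four_chain V l"
    by blast+
  note goodI' = notE[OF ng goodI]
  define P where "P = {x \<in> K. \<not> E a x}"
  define Q where "Q = {x \<in> K. \<not> E c x}"
  have PK: "P \<subseteq> K" and QK: "Q \<subseteq> K" unfolding P_def Q_def by blast+
  have finK: "finite K" using fin V by simp
  then have fin': "finite P" "finite Q" using PK QK finite_subset by blast+
  have Ea: "E a x \<longleftrightarrow> x \<notin> P" "E x a \<longleftrightarrow> x \<notin> P" "E b x \<longleftrightarrow> x \<notin> P" "E x b \<longleftrightarrow> x \<notin> P"
    "E c x \<longleftrightarrow> x \<notin> Q" "E x c \<longleftrightarrow> x \<notin> Q" if "x \<in> K" for x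
    using that twins[OF that] sym_iff[of x] unfolding P_def Q_def by blast+
  have ba: "E b a" using ab sym by blast
  have neK: "x \<noteq> a" "x \<noteq> b" "x \<noteq> c" if "x \<in> K" for x using that abc by blast+
  have big: "card M \<le> card K" if "M \<subseteq> V" "\<And>x y. x \<in> M \<Longrightarrow> y \<in> M \<Longrightarrow> x \<noteq> y \<Longrightarrow> E x y" for M
    using max[of M] that unfolding is_clique_def by blast
  \<comment> \<open>This bound and the next two compare \<open>K\<close> with cliques obtained by
    dropping non-neighbours and adding vertices outside: \<open>a, b\<close>, then \<open>c\<close>,
    then \<open>a, b, c\<close>.\<close>
  have P2: "2 \<le> card P"
  proof -
    have "card ((K - P) \<union> {a, b}) \<le> card K"
      by (rule big) (use V K Ea ab ba in \<open>blast+\<close>)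
    moreover have "card ((K - P) \<union> {a, b}) = card K - card P + 2"
      using abc finK fin' PK by (subst card_Un_disjoint) (auto simp: card_Diff_subset)
    ultimately show ?thesis using card_mono[OF finK PK] by linarith
  qed
  have Q1: "Q \<noteq> {}"
  proof
    assume "Q = {}"
    then have "card (insert c K) \<le> card K"
      by (intro big) (use V K Ea in \<open>blast+\<close>)
    then show False using abc finK by simp
  qed
  have PQ3: "3 \<le> card (P \<union> Q)" if "E a c" "E b c"
  proof -
    have "card ((K - (P \<union> Q)) \<union> {a, b, c}) \<le> card K"
      by (rule big) (use V K Ea ab ba that that[THEN sym] in \<open>blast+\<close>)
    moreover have "card ((K - (P \<union> Q)) \<union> {a, b, c}) = card K - card (P \<union> Q) + 3"
      using abc finK fin' PK QK by (subst card_Un_disjoint) (auto simp: card_Diff_subset)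
    moreover have "card (P \<union> Q) \<le> card K" using finK PK QK by (intro card_mono) blast+
    ultimately show ?thesis by linarith
  qed
  have otherP: "\<exists>w\<in>P. w \<noteq> x" for x
    using other_element[OF P2] by blast
  \<comment> \<open>Otherwise no edge would leave \<open>K\<close>.\<close>
  have PQK: "P \<inter> Q \<noteq> K"
  proof
    assume h: "P \<inter> Q = K"
    have "K \<subseteq> V \<and> K \<noteq> {} \<and> K \<noteq> V" using V abc Q1 QK by blast
    then obtain x y where "x \<in> K" "y \<in> V - K" "E x y"
      using linkedD[OF lk, of K] by blast
    then show False using V h Ea by blast
  qed
  \<comment> \<open>Here \<open>a, c, x, y\<close> are left out while \<open>b\<close> stays and
    separates \<open>x\<close> from \<open>y\<close>. A second element of \<open>P\<close> separates
    \<open>a\<close> from \<open>y\<close>. Only pairs containing \<open>c\<close> can fail, and the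
    remaining premises exclude this.\<close>
  have gA: False
    if x: "x \<in> P" and y: "y \<in> K - P"
      and e: "E a c \<Longrightarrow> E b c" "E a c \<Longrightarrow> \<exists>w\<in>K - {x, y}. (w \<in> P) \<noteq> (w \<in> Q)"
      and cx: "x \<notin> Q \<Longrightarrow> E b c \<or> Q \<noteq> {y}" and cy: "y \<notin> Q \<Longrightarrow> \<not> E b c \<or> Q \<noteq> {x}" for x y
  proof (rule goodI'[of a c x y "insert b (K - {x, y})"])
    have xy: "x \<in> K" "y \<in> K" "x \<noteq> y" using x y PK by blast+
    show "distinct [a, c, x, y]" using abc xy neK by auto
    show "{a, c, x, y} \<union> insert b (K - {x, y}) \<subseteq> V" using V xy by blast
    show "insert b (K - {x, y}) \<inter> {a, c, x, y} = {}" using abc xy neK by auto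
    show "E a c \<longrightarrow> (\<exists>w\<in>insert b (K - {x, y}). E a w \<noteq> E c w)"
      using e Ea by blast
    show "E a x \<longrightarrow> (\<exists>w\<in>insert b (K - {x, y}). E a w \<noteq> E x w)"
      using x Ea[OF xy(1)] by blast
    show "E a y \<longrightarrow> (\<exists>w\<in>insert b (K - {x, y}). E a w \<noteq> E y w)"
    proof -
      obtain w where "w \<in> P" "w \<noteq> x" using otherP by blast
      then have w: "w \<in> K - {x, y}" "\<not> E a w" using y PK Ea by blast+
      moreover have "E y w" using K[of y w] w(1) xy(2) by blast
      ultimately show ?thesis by blast
    qed
    have Qw: "\<exists>w\<in>insert b (K - {x, y}). E c w \<noteq> E z w"
      if "w \<in> Q" "w \<notin> {x, y}" "z = x \<or> z = y" for w z
    proof -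
      have w: "w \<in> K - {x, y}" "\<not> E c w" using that(1,2) QK Ea by blast+
      moreover have "E z w" using K[of z w] w(1) xy(1,2) that(3) by blast
      ultimately show ?thesis by blast
    qed
    have cb: "E c b = E b c" by (rule sym_iff)
    show "E c x \<longrightarrow> (\<exists>w\<in>insert b (K - {x, y}). E c w \<noteq> E x w)"
    proof
      assume "E c x"
      then have xQ: "x \<notin> Q" using xy Ea by blast
      have "\<not> E x b" using x Ea[OF xy(1)] by blast
      then show "\<exists>w\<in>insert b (K - {x, y}). E c w \<noteq> E x w"
        using cx[OF xQ] cb Qw[of _ x] xQ Q1 by blast
    qed
    show "E c y \<longrightarrow> (\<exists>w\<in>insert b (K - {x, y}). E c w \<noteq> E y w)"
    proof
      assume "E c y"
      then have yQ: "y \<notin> Q" using xy Ea by blast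
      have "E y b" using y Ea[OF xy(2)] by blast
      then show "\<exists>w\<in>insert b (K - {x, y}). E c w \<noteq> E y w"
        using cy[OF yQ] cb Qw[of _ y] yQ Q1 by blast
    qed
    show "E x y \<longrightarrow> (\<exists>w\<in>insert b (K - {x, y}). E x w \<noteq> E y w)"
      using x y Ea[OF xy(1)] Ea[OF xy(2)] by blast
  qed
  \<comment> \<open>Suppose \<open>c\<close> sees exactly one twin, \<open>p\<close>. If
    \<open>c\<close> has a neighbour in \<open>K\<close>, it stays and separates \<open>p\<close>
    from \<open>q\<close> as well as an element of \<open>Q\<close> from one outside. If
    \<open>Q = K\<close>, then \<open>q, c, x, y\<close> are left out: \<open>c\<close> sees none of
    the others and \<open>p\<close> separates \<open>x\<close> from \<open>y\<close>.\<close>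
  have gB: False if pq: "p = a \<and> q = b \<or> p = b \<and> q = a" and e: "E p c" "\<not> E q c" for p q
  proof -
    have V': "V = K \<union> {p, q, c}" and pqc: "p \<noteq> q" "p \<noteq> c" "q \<noteq> c" "p \<notin> K" "q \<notin> K"
      using pq V abc by auto
    have Ep: "E p x \<longleftrightarrow> x \<notin> P" "E x p \<longleftrightarrow> x \<notin> P" "E q x \<longleftrightarrow> x \<notin> P" "E x q \<longleftrightarrow> x \<notin> P" if "x \<in> K" for x
      using pq Ea[OF that] by blast+
    have sep: "\<exists>w\<in>insert d (K - {x, y}). E r w \<noteq> E z w"
      if r: "r = p \<or> r = q" and xy: "x \<in> K" "y \<in> K" and z: "z = x \<or> z = y" "E r z" for r x y z d
    proof -
      have zK: "z \<in> K" using xy z by blast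
      have zP: "z \<notin> P" using r z(2) Ep[OF zK] by blast
      obtain w where w: "w \<in> P" "w \<noteq> (if z = x then y else x)" using otherP by blast
      then have "w \<noteq> z" using zP by blast
      then have "w \<notin> {x, y}" "w \<in> K" using w z(1) PK by (auto split: if_splits)
      moreover have "\<not> E r w" using r w(1) Ep[OF \<open>w \<in> K\<close>] by blast
      moreover have "E z w" using K zK \<open>w \<in> K\<close> \<open>w \<noteq> z\<close> by blast
      ultimately show ?thesis by blast
    qed
    show False
    proof (cases "Q = K")
      case False
      then obtain x y where xy: "x \<in> Q" "y \<in> K - Q" using Q1 QK by blast
      then have xyK: "x \<in> K" "y \<in> K" "x \<noteq> y" using QK by blast+
      show False
      proof (rule goodI'[of p q x y "insert c (K - {x, y})"])
        show "distinct [p, q, x, y]" using pqc xyK by auto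
        show "{p, q, x, y} \<union> insert c (K - {x, y}) \<subseteq> V" using V' xyK by blast
        show "insert c (K - {x, y}) \<inter> {p, q, x, y} = {}" using pqc abc xyK by auto
        show "E p q \<longrightarrow> (\<exists>w\<in>insert c (K - {x, y}). E p w \<noteq> E q w)" using e by blast
        show "E x y \<longrightarrow> (\<exists>w\<in>insert c (K - {x, y}). E x w \<noteq> E y w)" using xy Ea[OF xyK(1)] Ea[OF xyK(2)] by blast
      qed (intro impI sep xyK; simp)+
    next
      case True
      then obtain y where y: "y \<in> K - P" using PQK PK by blast
      obtain x where x: "x \<in> P" using otherP by blast
      have xyK: "x \<in> K" "y \<in> K" "x \<noteq> y" using x y PK by blast+
      have c: "\<not> E c x" "\<not> E c y" using True xyK Ea[OF xyK(1)] Ea[OF xyK(2)] by blast+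
      show False
      proof (rule goodI'[of q c x y "insert p (K - {x, y})"])
        show "distinct [q, c, x, y]" using pqc abc xyK by auto
        show "{q, c, x, y} \<union> insert p (K - {x, y}) \<subseteq> V" using V' xyK by blast
        show "insert p (K - {x, y}) \<inter> {q, c, x, y} = {}" using pqc abc xyK by auto
        show "E x y \<longrightarrow> (\<exists>w\<in>insert p (K - {x, y}). E x w \<noteq> E y w)" using x y Ep[OF xyK(1)] Ep[OF xyK(2)] by blast
        show "E q x \<longrightarrow> (\<exists>w\<in>insert p (K - {x, y}). E q w \<noteq> E x w)"
          by (intro impI sep xyK) simp_all
        show "E q y \<longrightarrow> (\<exists>w\<in>insert p (K - {x, y}). E q w \<noteq> E y w)"
          by (intro impI sep xyK) simp_all
      qed (use e c in blast)+
    qed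
  qed
  define near :: "nat \<Rightarrow> nat \<Rightarrow> bool" where "near = (\<lambda>i j. i \<le> Suc j \<and> j \<le> Suc i)"
  have near_sym: "near i j = near j i" for i j unfolding near_def by blast
  have Vcases: "x \<in> K \<or> x = a \<or> x = b \<or> x = c" if "x \<in> V" for x
    using that V by blast
  have EbEa: "E b c = E a c" using gB by blast
  \<comment> \<open>Since \<open>K\<close> is complete and \<open>b\<close> behaves like
    \<open>a\<close> also towards \<open>c\<close>, a labelling needs to be checked only within
    \<open>K\<close>, from \<open>a\<close> and \<open>c\<close> to \<open>K\<close>, and between
    \<open>a\<close> and \<open>c\<close>.\<close>
  have chainI: "chain V l"
    if kk: "\<And>x y. x \<in> K \<Longrightarrow> y \<in> K \<Longrightarrow> near (l x) (l y)"
      and ka: "\<And>x. x \<in> K \<Longrightarrow> near (l a) (l x) \<longleftrightarrow> x \<notin> P"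
      and kc: "\<And>x. x \<in> K \<Longrightarrow> near (l c) (l x) \<longleftrightarrow> x \<notin> Q"
      and lb: "l b = l a" and ac: "near (l a) (l c) \<longleftrightarrow> E a c" for l
  proof -
    have nn: "near i i" for i unfolding near_def by simp
    have K': "E x y = near (l x) (l y)" if "x \<in> K" "y \<in> V" "x \<noteq> y" for x y
      using Vcases[OF that(2)]
    proof (elim disjE)
      assume "y \<in> K"
      then show ?thesis using K[OF that(1)] kk[OF that(1)] that(3) by simp
    qed (use Ea[OF that(1)] ka[OF that(1)] kc[OF that(1)] near_sym[of "l x"] lb in simp_all)
    have "E x y = near (l x) (l y)" if "x \<in> V" "y \<in> V" "x \<noteq> y" for x y
    proof (cases "x \<in> K \<or> y \<in> K")
      case True
      then show ?thesis
        using K'[of x y] K'[of y x] that near_sym[of "l x" "l y"] sym_iff[of x y] by auto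
    next
      case False
      have "x = a \<or> x = b \<or> x = c" "y = a \<or> y = b \<or> y = c"
        using that Vcases False by blast+
      then show ?thesis
        using that(3) by (elim disjE) (simp_all add: lb nn ab ba ac EbEa near_sym[of "l c" "l a"] sym_iff[of c a] sym_iff[of c b])
    qed
    then show ?thesis unfolding chain_def near_def by blast
  qed
  have lvl: "level V l m = (if i = m then X else {}) \<union> (if j = m then Y else {}) \<union>
      (if l a = m then {a} else {}) \<union> (if l b = m then {b} else {}) \<union> (if l c = m then {c} else {})"
    if "K = X \<union> Y" "\<forall>x\<in>X. l x = i" "\<forall>x\<in>Y. l x = j" for l m i j X Y
    unfolding level_def V that(1) using that(2,3) by auto
  obtain x0 where x0: "x0 \<in> P" using otherP by blast
  show False
  proof (cases "E a c")
    case False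
    have "\<exists>x\<in>{a, b}. \<exists>y\<in>V - {a, b}. E x y"
      by (rule linkedD[OF lk]) (use V abc in auto)
    then obtain d y where dy: "d = a \<or> d = b" "y \<in> V - {a, b}" "E d y" by blast
    then have "y \<noteq> c" using False EbEa by blast
    then have "y \<in> K" using dy(2) V by blast
    then have y: "y \<in> K - P" using dy Ea[OF \<open>y \<in> K\<close>] by blast
    \<comment> \<open>When \<open>c\<close> sees neither twin, the only premise of \<open>gA\<close>
      that can fail concerns the pair of \<open>c\<close> and \<open>x\<close>.\<close>
    have F: "x \<notin> Q \<and> Q = {z}" if "x \<in> P" "z \<in> K - P" for x z
      using gA[OF that] False EbEa by blast
    have Qy: "Q = {y}" and KP: "K - P = {y}" using F[OF x0] y by blast+
    \<comment> \<open>The levels in order are \<open>{c}\<close>, \<open>P\<close>,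
      \<open>{y}\<close>, \<open>{a, b}\<close>.\<close>
    define l where "l = (\<lambda>x. if x = c then 0 else if x \<in> P then 1 else if x = y then 2 else 3 :: nat)"
    have Kl: "l x = (if x = y then 2 else 1)" "x \<notin> P \<longleftrightarrow> x = y" if "x \<in> K" for x
      using that KP neK[OF that] unfolding l_def by auto
    have al: "l a = 3" "l b = 3" "l c = 0" using abc PK y unfolding l_def by auto
    have ch: "chain V l"
      by (rule chainI) (simp_all add: Kl al near_def Qy False EbEa)
    have KX: "K = P \<union> {y}" using KP PK by blast
    have lX: "\<forall>x\<in>P. l x = 1"
      using PK abc y unfolding l_def by auto
    have lY: "\<forall>x\<in>{y}. l x = 2"
      using y abc unfolding l_def by auto
    note L = lvl[OF KX lX lY, unfolded al]
    have "level V l 0 = {c}" "level V l 1 = P" "level V l 2 = {y}" "level V l 3 = {a, b}"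
      by (auto simp: L)
    moreover have "\<forall>x\<in>V. l x \<le> 3" unfolding l_def by simp
    moreover have "card {a, b} = 2" using abc by simp
    ultimately have "four_chain V l"
      unfolding four_chain_def using ch P2 x0 by auto
    then show False using n4 by blast
  next
    case True
    then have bc: "E b c" using EbEa by blast
    \<comment> \<open>When \<open>c\<close> sees both twins, \<open>gA\<close> can fail in two ways:
      \<open>c\<close> is not separated from \<open>y\<close>, or \<open>c\<close> is not separated
      from \<open>a\<close>.\<close>
    have F: "Q = {x} \<or> (\<forall>w\<in>K - {x, y}. (w \<in> P) = (w \<in> Q))" if "x \<in> P" "y \<in> K - P" for x y
      using gA[OF that] bc by blast
    show False
    proof (cases "P = K")
      case PK': True
      then have "K - Q \<noteq> {}" using PQK QK by blast
      \<comment> \<open>The twins see nothing of \<open>K\<close>, so the levels are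
        \<open>Q\<close>, \<open>K - Q\<close>, \<open>{c}\<close>, \<open>{a, b}\<close>.\<close>
      define l where "l = (\<lambda>x. if x \<in> Q then 0 else if x \<in> K then 1 else if x = c then 2 else 3 :: nat)"
      have Kl: "l x = (if x \<in> Q then 0 else 1)" if "x \<in> K" for x
        using that unfolding l_def by simp
      have al: "l a = 3" "l b = 3" "l c = 2" using abc QK unfolding l_def by auto
      have ch: "chain V l"
        by (rule chainI) (simp_all add: Kl al near_def PK' True EbEa)
      have KX: "K = Q \<union> (K - Q)" using QK by blast
      have lX: "\<forall>x\<in>Q. l x = 0"
        using QK abc unfolding l_def by auto
      have lY: "\<forall>x\<in>(K - Q). l x = 1"
        using abc unfolding l_def by auto
      note L = lvl[OF KX lX lY, unfolded al]
      have "level V l 0 = Q" "level V l 1 = K - Q" "level V l 2 = {c}" "level V l 3 = {a, b}"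
        by (auto simp: L)
      moreover have "\<forall>x\<in>V. l x \<le> 3" unfolding l_def by simp
      moreover have "card {a, b} = 2" using abc by simp
      moreover have "P \<union> Q = K" using PK' QK by blast
      then have "3 \<le> card Q + card (K - Q)"
        using PQ3[OF True bc] finK QK by (simp add: card_Diff_subset fin' card_mono)
      ultimately have "four_chain V l"
        unfolding four_chain_def using ch Q1 \<open>K - Q \<noteq> {}\<close> by auto
      then show False using n4 by blast
    next
      case PK': False
      then obtain y where y: "y \<in> K - P" using PK by blast
      show False
      proof (cases "P = Q")
        case PQ: True
        \<comment> \<open>All three outer vertices have the same neighbours in \<open>K\<close>; the
          levels are \<open>P\<close>, \<open>K - P\<close>, \<open>{a, b, c}\<close>.\<close>
        define l where "l = (\<lambda>x. if x \<in> P then 0 else if x \<in> K then 1 else 2 :: nat)"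
        have Kl: "l x = (if x \<in> P then 0 else 1)" if "x \<in> K" for x
          using that unfolding l_def by simp
        have al: "l a = 2" "l b = 2" "l c = 2" using abc PK unfolding l_def by auto
        have ch: "chain V l"
          by (rule chainI) (simp_all add: Kl al near_def PQ[symmetric] True EbEa)
        have KX: "K = P \<union> (K - P)" using PK by blast
        have lX: "\<forall>x\<in>P. l x = 0"
          using PK abc unfolding l_def by auto
        have lY: "\<forall>x\<in>(K - P). l x = 1"
          using abc unfolding l_def by auto
        note L = lvl[OF KX lX lY, unfolded al]
        have "level V l 0 = P" "level V l 1 = K - P" "level V l 2 = {a, b, c}"
          by (auto simp: L)
        moreover have "\<forall>x\<in>V. l x \<le> 2" unfolding l_def by simp
        moreover have "card {a, b, c} = 3" using abc by simp
        moreover have "3 \<le> card P" using PQ3[OF True bc] PQ by simp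
        ultimately have "three_chain V l"
          unfolding three_chain_def using ch y by auto
        then show False using n3 by blast
      next
        case PQ: False
        \<comment> \<open>For \<open>Q = {x}\<close>, apply \<open>F\<close> to an element of
          \<open>P\<close> other than \<open>x\<close>; a further element of \<open>P\<close>
          outside \<open>Q\<close> contradicts the agreement. If \<open>x\<close> lies in
          \<open>P\<close>, it is \<open>PQ3\<close> that supplies this further element.\<close>
        have Qx: "Q \<noteq> {x}" for x
        proof
          assume Q: "Q = {x}"
          show False
          proof (cases "x \<in> P")
            case xP: True
            obtain x' where x': "x' \<in> P" "x' \<noteq> x" using otherP by blast
            have "P \<union> Q = P" using Q xP by blast
            then have "3 \<le> card P" using PQ3[OF True bc] by simp
            then obtain w where w: "w \<in> P" "w \<noteq> x" "w \<noteq> x'" by (rule third_element)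
            then have "w \<in> K - {x', y}" "w \<notin> Q" using PK y Q by blast+
            then show False using F[OF x'(1) y] Q x'(2) w(1) by blast
          next
            case xP: False
            obtain u w where uw: "u \<in> P" "w \<in> P" "u \<noteq> w" using P2 by (rule two_elements)
            then have "w \<in> K - {u, y}" "w \<notin> Q" "Q \<noteq> {u}" using PK y Q xP by blast+
            then show False using F[OF uw(1) y] uw(2) by blast
          qed
        qed
        obtain u w where uw: "u \<in> P" "w \<in> P" "u \<noteq> w" using P2 by (rule two_elements)
        \<comment> \<open>\<open>P\<close> offers two choices for the first exceptional element in
          \<open>F\<close>; taking one different from \<open>z\<close> leaves \<open>d\<close> as
          the only exception.\<close>
        have agree: "(z \<in> P) = (z \<in> Q)" if "z \<in> K" "z \<noteq> d" "d \<in> K - P" for z d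
        proof (cases "z = u")
          case True
          then show ?thesis using F[OF uw(2) that(3)] Qx that uw(3) by blast
        next
          case False
          then show ?thesis using F[OF uw(1) that(3)] Qx that by blast
        qed
        obtain w where w: "w \<in> K" "(w \<in> P) \<noteq> (w \<in> Q)" using PQ PK QK by blast
        \<comment> \<open>A place of disagreement coincides with every element of
          \<open>K - P\<close>, so \<open>K - P\<close> is a single vertex.\<close>
        have wd: "d = w" if "d \<in> K - P" for d
          using agree[OF w(1) _ that] w(2) by blast
        then have KP: "K - P = {y}" using y by blast
        have "y \<in> Q" using wd[OF y] w(2) y by blast
        moreover have "P \<subseteq> Q"
        proof
          fix z assume "z \<in> P"
          then show "z \<in> Q" using agree[of z y] PK y by blast
        qed
        moreover have "K = P \<union> {y}" using KP PK by blast
        ultimately have QK': "Q = K" using QK by blast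
        \<comment> \<open>Now \<open>c\<close> sees nothing of \<open>K\<close>, and the levels are
          \<open>{c}\<close>, \<open>{a, b}\<close>, \<open>{y}\<close>, \<open>P\<close>.\<close>
        define l where "l = (\<lambda>x. if x = c then 0 else if x \<in> P then 3 else if x = y then 2 else 1 :: nat)"
        have Kl: "l x = (if x = y then 2 else 3)" "x \<notin> P \<longleftrightarrow> x = y" if "x \<in> K" for x
          using that KP neK[OF that] unfolding l_def by auto
        have al: "l a = 1" "l b = 1" "l c = 0" using abc PK y unfolding l_def by auto
        have ch: "chain V l"
          by (rule chainI) (simp_all add: Kl al near_def QK' True EbEa)
        have KX: "K = P \<union> {y}" using KP PK by blast
        have lX: "\<forall>x\<in>P. l x = 3"
          using PK abc y unfolding l_def by auto
        have lY: "\<forall>x\<in>{y}. l x = 2"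
          using y abc unfolding l_def by auto
        note L = lvl[OF KX lX lY, unfolded al]
        have "level V l 0 = {c}" "level V l 1 = {a, b}" "level V l 2 = {y}" "level V l 3 = P"
          by (auto simp: L)
        moreover have "\<forall>x\<in>V. l x \<le> 3" unfolding l_def by simp
        moreover have "card {a, b} = 2" using abc by simp
        ultimately have "four_chain V l"
          unfolding four_chain_def using ch P2 by auto
        then show False using n4 by blast
      qed
    qed
  qed
qed

text \<open>The pairs \<open>a, b\<close> and \<open>a, c\<close> differ at \<open>x\<close>, and
  \<open>b, c\<close> differ at \<open>y\<close>. So a third vertex \<open>z\<close> of
  \<open>K\<close> would violate \<open>cover\<close>, and \<open>K = {x, y}\<close>. As
  \<open>K\<close> is a maximum clique, there are no triangles, which decides the non-edges of the
  cycle.\<close>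

lemma clique_two_cycle:
  assumes V: "V = K \<union> {a, b, c}"
    and abc: "a \<noteq> b" "a \<noteq> c" "b \<noteq> c" "a \<notin> K" "b \<notin> K" "c \<notin> K"
    and K: "\<And>x y. x \<in> K \<Longrightarrow> y \<in> K \<Longrightarrow> x \<noteq> y \<Longrightarrow> E x y"
    and max: "\<And>M. is_clique V E M \<Longrightarrow> card M \<le> card K"
    and x: "x \<in> K" "y \<in> K" "E a b" "E b c"
    and ab: "\<And>w. w \<in> K \<Longrightarrow> E a w \<noteq> E b w \<longleftrightarrow> w = x"
    and bc: "\<And>w. w \<in> K \<Longrightarrow> E b w \<noteq> E c w \<longleftrightarrow> w = y"
    and xy: "x \<noteq> y"
    and cover: "\<And>z. z \<in> K \<Longrightarrow> \<exists>p\<in>{a, b, c}. \<exists>q\<in>{a, b, c}. p \<noteq> q \<and> (\<forall>w\<in>K - {z}. E p w = E q w)"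
  shows "five_cycle V a b c y x"
proof -
  have "z = x \<or> z = y" if z: "z \<in> K" for z
  proof (rule ccontr)
    assume n: "\<not> ?thesis"
    obtain p q where pq: "p \<in> {a, b, c}" "q \<in> {a, b, c}" "p \<noteq> q" and e: "\<forall>w\<in>K - {z}. E p w = E q w"
      using cover[OF z] by blast
    have "x \<in> K - {z}" "y \<in> K - {z}" using x n by blast+
    then have exy: "E p x = E q x" "E p y = E q y" using e by blast+
    have "E a x \<noteq> E b x" "E b y \<noteq> E c y" "E b x = E c x" "E a y = E b y"
      using ab bc x xy by blast+
    then show False using pq exy by auto
  qed
  then have Kxy: "K = {x, y}" using x by blast
  have big: "card M \<le> 2" if "M \<subseteq> V" "\<And>x y. x \<in> M \<Longrightarrow> y \<in> M \<Longrightarrow> x \<noteq> y \<Longrightarrow> E x y" for M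
    using max[of M] that xy unfolding is_clique_def Kxy by simp
  have tri: False if "p \<in> V" "q \<in> V" "r \<in> V" "p \<noteq> q" "p \<noteq> r" "q \<noteq> r" "E p q" "E p r" "E q r" for p q r
  proof -
    have "card {p, q, r} \<le> 2"
    proof (rule big)
      show "{p, q, r} \<subseteq> V" using that by blast
      show "E u v" if "u \<in> {p, q, r}" "v \<in> {p, q, r}" "u \<noteq> v" for u v
        using that \<open>E p q\<close> \<open>E p r\<close> \<open>E q r\<close> sym by blast
    qed
    then show False using that(4-6) by simp
  qed
  have inV: "a \<in> V" "b \<in> V" "c \<in> V" "x \<in> V" "y \<in> V" using V x by blast+
  have ne: "a \<noteq> x" "a \<noteq> y" "b \<noteq> x" "b \<noteq> y" "c \<noteq> x" "c \<noteq> y" using abc x by blast+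
  have xyE: "E x y" using K x xy by blast
  have ay: "E a y = E b y" and cx: "E b x = E c x" and ax: "E a x \<noteq> E b x" and cy: "E b y \<noteq> E c y"
    using ab[OF x(1)] ab[OF x(2)] bc[OF x(1)] bc[OF x(2)] xy by blast+
  have nby: "\<not> E b y" using tri[of a b y] inV ne abc x ay by blast
  have nbx: "\<not> E b x" using tri[of b c x] inV ne abc x cx by blast
  have nac: "\<not> E a c" using tri[of a b c] inV ne abc x by blast
  show ?thesis
    unfolding five_cycle_def
  proof (intro conjI)
    show "V = {a, b, c, y, x}" using V Kxy by blast
    show "distinct [a, b, c, y, x]" using abc ne xy by auto
  qed (use x nby nbx nac ay cx ax cy xyE sym sym_iff[of x] in blast)+
qed

text \<open>For each \<open>z\<close> in \<open>K\<close>, leaving out \<open>z\<close> and the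
  three outer vertices fails, so some adjacent outer pair differs at most at \<open>z\<close>. Not
  being twins on \<open>K\<close>, it differs exactly there. Two choices of \<open>z\<close> thus
  give two different outer edges, which form a path.\<close>

lemma clique_two_step:
  assumes lk: "linked V" and fin: "finite V" and K: "is_clique V E K" and cK: "card V = card K + 3" "2 \<le> card K"
    and max: "\<And>M. is_clique V E M \<Longrightarrow> card M \<le> card K"
  shows "good V \<or> (\<exists>p q r s t. five_cycle V p q r s t) \<or> (\<exists>l. three_chain V l) \<or> (\<exists>l. four_chain V l)"
proof (rule ccontr)
  assume "\<not> ?thesis"
  then have ng: "\<not> good V" and n5: "\<And>p q r s t. \<not> five_cycle V p q r s t"
    and n3: "\<not> (\<exists>l. three_chain V l)" and n4: "\<not> (\<exists>l. four_chain V l)"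
    by blast+
  have KV: "K \<subseteq> V" and KK: "\<And>x y. x \<in> K \<Longrightarrow> y \<in> K \<Longrightarrow> x \<noteq> y \<Longrightarrow> E x y"
    using K unfolding is_clique_def by blast+
  have finK: "finite K" using KV fin finite_subset by blast
  have "card (V - K) = 3" using cK KV finK by (simp add: card_Diff_subset)
  then obtain a b c where abc0: "V - K = {a, b, c}" "a \<noteq> b" "a \<noteq> c" "b \<noteq> c"
    unfolding card_3_iff by blast
  have V: "V = K \<union> {a, b, c}" using abc0(1) KV by blast
  have abc: "a \<noteq> b" "a \<noteq> c" "b \<noteq> c" "a \<notin> K" "b \<notin> K" "c \<notin> K" using abc0 by blast+
  have non: "\<exists>n\<in>K. \<not> E p n" if p: "p \<in> {a, b, c}" for p
  proof (rule ccontr)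
    assume "\<not> ?thesis"
    then have "is_clique V E (insert p K)"
      using KK KV p V sym unfolding is_clique_def by blast
    then have "card (insert p K) \<le> card K" by (rule max)
    then show False using finK p abc by auto
  qed
  have twins: "\<exists>w\<in>K. E p w \<noteq> E q w" if pq: "p \<in> {a, b, c}" "q \<in> {a, b, c}" "p \<noteq> q" "E p q" for p q
  proof (rule ccontr)
    assume "\<not> ?thesis"
    then have e: "E p w = E q w" if "w \<in> K" for w using that by blast
    obtain r where r: "{a, b, c} = {p, q, r}" "p \<noteq> r" "q \<noteq> r"
      using pq(1-3) abc by (elim insertE emptyE) auto
    have "{p, q, r} \<inter> K = {}" unfolding r(1)[symmetric] using abc by blast
    then have "V = K \<union> {p, q, r}" "p \<notin> K" "q \<notin> K" "r \<notin> K"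
      using V[unfolded r(1)] by blast+
    then have "good V \<or> (\<exists>l. three_chain V l) \<or> (\<exists>l. four_chain V l)"
      using clique_two_twins[OF lk fin _ pq(3) r(2,3) _ _ _ KK max pq(4) e] by blast
    then show False using ng n3 n4 by blast
  qed
  have all: "\<exists>p\<in>{a, b, c}. \<exists>q\<in>{a, b, c}. p \<noteq> q \<and> E p q \<and> (\<forall>w\<in>K - {z}. E p w = E q w)" if z: "z \<in> K" for z
  proof (rule ccontr)
    assume n: "\<not> ?thesis"
    then have sep: "E p q \<longrightarrow> (\<exists>w\<in>K - {z}. E p w \<noteq> E q w)"
      if "p \<in> {a, b, c}" "q \<in> {a, b, c}" "p \<noteq> q" for p q
      using that by blast
    \<comment> \<open>A non-neighbour of \<open>p\<close> in \<open>K\<close> is adjacent to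
      \<open>z\<close>, hence separates the two; it exists by maximality of
      \<open>K\<close>.\<close>
    have sepz: "E p z \<longrightarrow> (\<exists>w\<in>K - {z}. E p w \<noteq> E z w)" if "p \<in> {a, b, c}" for p
      using non[OF that] KK z by blast
    have "good V"
    proof (rule goodI[of a b c z "K - {z}"])
      show "distinct [a, b, c, z]" using abc z by auto
      show "{a, b, c, z} \<union> (K - {z}) \<subseteq> V" using V z by blast
      show "(K - {z}) \<inter> {a, b, c, z} = {}" using abc by blast
    qed (intro sep sepz; use abc in simp)+
    then show False using ng by blast
  qed
  obtain x y where xy: "x \<in> K" "y \<in> K" "x \<noteq> y" using cK(2) by (rule two_elements)
  have only: "E p w \<noteq> E q w \<longleftrightarrow> w = z"
    if pq: "p \<in> {a, b, c}" "q \<in> {a, b, c}" "p \<noteq> q" "E p q" "\<forall>w\<in>K - {z}. E p w = E q w" and w: "w \<in> K" for p q z w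
    using twins[OF pq(1-4)] pq(5) w by blast
  obtain p q where pq: "p \<in> {a, b, c}" "q \<in> {a, b, c}" "p \<noteq> q" "E p q" "\<forall>w\<in>K - {x}. E p w = E q w"
    using all[OF xy(1)] by blast
  obtain r s where rs: "r \<in> {a, b, c}" "s \<in> {a, b, c}" "r \<noteq> s" "E r s" "\<forall>w\<in>K - {y}. E r w = E s w"
    using all[OF xy(2)] by blast
  have differ: "\<not> (r = p \<and> s = q \<or> r = q \<and> s = p)"
  proof
    assume "r = p \<and> s = q \<or> r = q \<and> s = p"
    then have "E p x = E q x" using rs(5) xy by blast
    then show False using only[OF pq xy(1)] by blast
  qed
  \<comment> \<open>The two outer edges share a vertex, but which one is unknown. Renaming along the
    path treats the four possibilities at once.\<close>
  have cyc: "five_cycle V p' q' s' y x"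
    if "{p', q'} = {p, q}" "{q', s'} = {r, s}" for p' q' s'
  proof -
    have e1: "p' \<in> {a, b, c}" "q' \<in> {a, b, c}" "p' \<noteq> q'" "E p' q'" "\<forall>w\<in>K - {x}. E p' w = E q' w"
      using that(1) pq sym[OF pq(4)] by (auto simp: doubleton_eq_iff)
    have e2: "q' \<in> {a, b, c}" "s' \<in> {a, b, c}" "q' \<noteq> s'" "E q' s'" "\<forall>w\<in>K - {y}. E q' w = E s' w"
      using that(2) rs sym[OF rs(4)] by (auto simp: doubleton_eq_iff)
    have "p' \<noteq> s'" using that differ by (auto simp: doubleton_eq_iff)
    then have S: "{a, b, c} = {p', q', s'}" using e1(1-3) e2(1-3) abc by blast
    show ?thesis
    proof (rule clique_two_cycle[OF _ e1(3) \<open>p' \<noteq> s'\<close> e2(3) _ _ _ KK max xy(1,2) e1(4) e2(4) only[OF e1] only[OF e2] xy(3)])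
      show "V = K \<union> {p', q', s'}" using V unfolding S .
      show "p' \<notin> K" "q' \<notin> K" "s' \<notin> K" using abc e1(1,2) e2(2) by blast+
      show "\<exists>p\<in>{p', q', s'}. \<exists>q\<in>{p', q', s'}. p \<noteq> q \<and> (\<forall>w\<in>K - {z}. E p w = E q w)" if "z \<in> K" for z
        using all[OF that] unfolding S by blast
    qed
  qed
  have "p = r \<or> p = s \<or> q = r \<or> q = s"
    using pq(1-3) rs(1-3) by auto
  then show False
    using cyc[of q p s] cyc[of q p r] cyc[of p q s] cyc[of p q r] n5 by (auto simp: insert_commute)
qed

text \<open>A clique of size \<open>n - 3\<close> leads to \<open>clique_two_step\<close>. Otherwise
  a non-cut vertex is deleted, the clique bound survives with one vertex fewer, and the extension
  lemmas put the vertex back.\<close>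

lemma classification:
  assumes "finite V" "linked V" "5 \<le> card V" "\<And>M. is_clique V E M \<Longrightarrow> card M \<le> card V - 3"
  shows "good V \<or> (\<exists>p q r s t. five_cycle V p q r s t) \<or> (\<exists>l. three_chain V l) \<or> (\<exists>l. four_chain V l)"
  using assms
proof (induction "card V" arbitrary: V rule: less_induct)
  case less
  show ?case
  proof (cases "\<exists>K. is_clique V E K \<and> card K = card V - 3")
    case True
    then obtain K where K: "is_clique V E K" "card K = card V - 3" by blast
    show ?thesis
      by (rule clique_two_step[OF less.prems(2,1) K(1)]) (use K less.prems(3,4) in auto)
  next
    case False
    then have small: "card M < card V - 3" if "is_clique V E M" for M
      using less.prems(4)[OF that] that by (metis le_neq_implies_less)
    have "2 \<le> card V" using less.prems(3) by linarith
    then obtain v where v: "v \<in> V" "linked (V - {v})" by (rule linked_remove[OF less.prems(2,1)])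
    have "V \<noteq> {v}" using less.prems(3) by auto
    then obtain y where "y \<in> V" "E v y" using linkedD[OF less.prems(2), of "{v}"] v by blast
    then have "is_clique V E {v, y}" "v \<noteq> y" using v sym irrefl unfolding is_clique_def by auto
    \<comment> \<open>An edge is a clique of size two, so the strict bound gives
      \<open>n \<ge> 6\<close> and the induction hypothesis meets at least five vertices.\<close>
    then have "2 < card V - 3" using small[of "{v, y}"] by simp
    then have c: "5 \<le> card (V - {v})" "card (V - {v}) < card V" "card (V - {v}) = card V - 1" using less.prems(1) v by simp_all
    have IH: "good (V - {v}) \<or> (\<exists>p q r s t. five_cycle (V - {v}) p q r s t) \<or> (\<exists>l. three_chain (V - {v}) l) \<or> (\<exists>l. four_chain (V - {v}) l)"
    proof (rule less.hyps[OF c(2) _ v(2) c(1)])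
      show "finite (V - {v})" using less.prems(1) by simp
      fix M assume "is_clique (V - {v}) E M"
      then have "is_clique V E M" unfolding is_clique_def by blast
      then show "card M \<le> card (V - {v}) - 3" using small[of M] c(3) by linarith
    qed
    have ins: "insert v (V - {v}) = V" using v by blast
    have lk: "linked (insert v (V - {v}))" and fin: "finite (V - {v})" and nin: "v \<notin> V - {v}"
      using less.prems ins by simp_all
    show ?thesis
      using IH good_mono[of "V - {v}" V] five_cycle_extend[OF _ nin lk] three_chain_extend[OF _ fin nin lk]
        four_chain_extend[OF _ fin nin lk] unfolding ins by blast
  qed
qed

end

section \<open>Distances and the local metric dimension\<close>

lemma is_walk_Cons:
  assumes "xs \<noteq> []"
  shows "is_walk V E (x # xs) \<longleftrightarrow> x \<in> V \<and> E x (hd xs) \<and> is_walk V E xs"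
proof -
  have "(\<forall>i. Suc i < length (x # xs) \<longrightarrow> E ((x # xs) ! i) ((x # xs) ! Suc i)) \<longleftrightarrow>
    E x (hd xs) \<and> (\<forall>i. Suc i < length xs \<longrightarrow> E (xs ! i) (xs ! Suc i))"
    (is "?L \<longleftrightarrow> ?R")
  proof
    assume L: ?L
    have "E x (hd xs)" using L[rule_format, of 0] assms by (simp add: hd_conv_nth)
    moreover have "E (xs ! i) (xs ! Suc i)" if "Suc i < length xs" for i
      using L[rule_format, of "Suc i"] that by simp
    ultimately show ?R by blast
  next
    assume R: ?R
    show ?L
    proof (intro allI impI)
      fix i assume "Suc i < length (x # xs)"
      then show "E ((x # xs) ! i) ((x # xs) ! Suc i)"
        using R assms by (cases i) (simp_all add: hd_conv_nth)
    qed
  qed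
  then show ?thesis unfolding is_walk_def using assms by auto
qed

lemma card_bij_preimage:
  assumes "bij_betw f V N" "T \<subseteq> N"
  shows "card {x \<in> V. f x \<in> T} = card T"
proof -
  have "bij_betw f {x \<in> V. f x \<in> T} T"
    using assms unfolding bij_betw_def inj_on_def by auto
  then show ?thesis by (rule bij_betw_same_card)
qed

lemma obtain_shifted_bij:
  fixes k :: nat
  assumes "finite A"
  obtains f where "bij_betw f A {k..<k + card A}"
proof -
  obtain g where "bij_betw g A {0..<card A}" using ex_bij_betw_finite_nat[OF assms] by blast
  moreover have "bij_betw (\<lambda>i. k + i) {0..<card A} {k..<k + card A}"
    by (rule bij_betw_byWitness[where f' = "\<lambda>i. i - k"]) auto
  ultimately have "bij_betw ((\<lambda>i. k + i) \<circ> g) A {k..<k + card A}" by (rule bij_betw_trans)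
  then show ?thesis by (rule that)
qed

section \<open>Walks, distances and connectedness\<close>

locale connected_simple_graph =
  fixes V :: "'a set" and E :: "'a \<Rightarrow> 'a \<Rightarrow> bool"
  assumes simple: "simple_graph V E" and connected: "connected_graph V E"
begin

sublocale adjacency E
  using simple unfolding simple_graph_def by unfold_locales blast+

lemma finite_V: "finite V" and E_in_V: "E x y \<Longrightarrow> x \<in> V \<and> y \<in> V"
  using simple unfolding simple_graph_def by blast+

text \<open>The parameter counts edges, one less than the length of the list. The recursion in
  \<open>walk_0\<close> and \<open>walk_Suc\<close> then replaces reasoning about lists.\<close>

definition walk :: "nat \<Rightarrow> 'a \<Rightarrow> 'a \<Rightarrow> bool" where
  "walk k x y \<longleftrightarrow> (\<exists>xs. is_walk V E xs \<and> hd xs = x \<and> last xs = y \<and> length xs = Suc k)"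

lemma walk_0: "walk 0 x y \<longleftrightarrow> x \<in> V \<and> x = y"
proof
  assume "walk 0 x y"
  then obtain xs where xs: "is_walk V E xs" "hd xs = x" "last xs = y" "length xs = Suc 0"
    unfolding walk_def by blast
  then obtain z where "xs = [z]" by (metis length_0_conv length_Suc_conv)
  then show "x \<in> V \<and> x = y" using xs unfolding is_walk_def by simp
next
  assume "x \<in> V \<and> x = y"
  then show "walk 0 x y" unfolding walk_def is_walk_def by (intro exI[of _ "[x]"]) auto
qed

lemma walk_Suc: "walk (Suc k) x y \<longleftrightarrow> (\<exists>z. E x z \<and> walk k z y)"
proof
  assume "walk (Suc k) x y"
  then obtain xs where xs: "is_walk V E xs" "hd xs = x" "last xs = y" "length xs = Suc (Suc k)"
    unfolding walk_def by blast
  then obtain ys where ys: "xs = x # ys" "length ys = Suc k" by (cases xs) auto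
  then have "ys \<noteq> []" by auto
  then have "E x (hd ys) \<and> walk k (hd ys) y"
    using xs ys unfolding walk_def by (auto simp: is_walk_Cons)
  then show "\<exists>z. E x z \<and> walk k z y" by blast
next
  assume "\<exists>z. E x z \<and> walk k z y"
  then obtain z ys where z: "E x z" "is_walk V E ys" "hd ys = z" "last ys = y" "length ys = Suc k"
    unfolding walk_def by blast
  then have "ys \<noteq> []" by auto
  then show "walk (Suc k) x y"
    using z E_in_V[OF z(1)] unfolding walk_def by (intro exI[of _ "x # ys"]) (simp add: is_walk_Cons)
qed

lemma gdist_walk: "gdist V E x y = (LEAST k. walk k x y)"
  unfolding gdist_def walk_def ..

lemma gdist_le: "walk k x y \<Longrightarrow> gdist V E x y \<le> k"
  unfolding gdist_walk by (rule Least_le)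

lemma walk_gdist:
  assumes "x \<in> V" "y \<in> V"
  shows "walk (gdist V E x y) x y"
proof -
  obtain xs where xs: "is_walk V E xs" "hd xs = x" "last xs = y"
    using connected assms unfolding connected_graph_def by blast
  then have "length xs = Suc (length xs - 1)" unfolding is_walk_def by (cases xs) simp_all
  then have "walk (length xs - 1) x y" using xs unfolding walk_def by blast
  then show ?thesis unfolding gdist_walk by (rule LeastI)
qed

text \<open>A walk from a vertex of \<open>A\<close> to one outside must cross the cut at some
  step.\<close>

lemma linked_V: "linked V"
  unfolding linked_def
proof (intro allI impI)
  fix A assume A: "A \<subseteq> V \<and> A \<noteq> {} \<and> A \<noteq> V"
  have escape: "\<exists>x\<in>A. \<exists>y\<in>V - A. E x y" if "walk k x y" "x \<in> A" "y \<in> V - A" for k x y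
    using that
  proof (induction k arbitrary: x)
    case 0
    then show ?case by (simp add: walk_0)
  next
    case (Suc k)
    then obtain z where z: "E x z" "walk k z y" by (auto simp: walk_Suc)
    show ?case
    proof (cases "z \<in> A")
      case True
      then show ?thesis using Suc.IH z Suc.prems by blast
    next
      case False
      then show ?thesis using z E_in_V Suc.prems by blast
    qed
  qed
  obtain x y where "x \<in> A" "y \<in> V - A" using A by blast
  then show "\<exists>x\<in>A. \<exists>y\<in>V - A. E x y" using escape[OF walk_gdist[of x y]] A by blast
qed

lemma gdist_eq_1_iff:
  assumes "x \<in> V" "y \<in> V"
  shows "gdist V E x y = 1 \<longleftrightarrow> E x y"
proof
  assume "gdist V E x y = 1"
  then show "E x y" using walk_gdist[OF assms] by (simp add: walk_0 walk_Suc)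
next
  assume e: "E x y"
  then have "gdist V E x y \<le> 1" by (intro gdist_le) (simp add: walk_0 walk_Suc assms)
  moreover have "gdist V E x y \<noteq> 0"
    using walk_gdist[OF assms] e irrefl by (metis walk_0)
  ultimately show "gdist V E x y = 1" by linarith
qed

lemma gdist_eq_2_iff:
  assumes "x \<in> V" "y \<in> V" "x \<noteq> y" "\<not> E x y"
  shows "gdist V E x y = 2 \<longleftrightarrow> (\<exists>z. E x z \<and> E z y)"
proof
  assume "gdist V E x y = 2"
  then have "walk (Suc (Suc 0)) x y" using walk_gdist[OF assms(1,2)] by (simp add: numeral_2_eq_2)
  then show "\<exists>z. E x z \<and> E z y" by (auto simp: walk_0 walk_Suc)
next
  assume "\<exists>z. E x z \<and> E z y"
  then have "walk (Suc (Suc 0)) x y" using assms by (auto simp: walk_0 walk_Suc)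
  then have "gdist V E x y \<le> 2" using gdist_le by fastforce
  moreover have "gdist V E x y \<noteq> 0" using walk_gdist[OF assms(1,2)] assms(3) by (metis walk_0)
  moreover have "gdist V E x y \<noteq> 1" using gdist_eq_1_iff assms by blast
  ultimately show "gdist V E x y = 2" by linarith
qed

text \<open>Take a shortest walk from \<open>x\<close>. If its first step leads to \<open>y\<close>,
  drop that step; otherwise \<open>y\<close> can take the same first step.\<close>

lemma gdist_twins_le:
  assumes "x \<in> V" "w \<in> V" "w \<noteq> x" "\<And>z. z \<in> V \<Longrightarrow> z \<noteq> x \<Longrightarrow> z \<noteq> y \<Longrightarrow> E x z = E y z"
  shows "gdist V E y w \<le> gdist V E x w"
proof (cases "gdist V E x w")
  case 0
  then show ?thesis using walk_gdist[OF assms(1,2)] assms(3) by (simp add: walk_0)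
next
  case (Suc k)
  then obtain z where z: "E x z" "walk k z w" using walk_gdist[OF assms(1,2)] by (auto simp: walk_Suc)
  show ?thesis
  proof (cases "z = y")
    case True
    then show ?thesis using gdist_le z(2) Suc by fastforce
  next
    case False
    then have "E y z" using assms(4)[of z] z(1) E_in_V irrefl by blast
    then have "walk (Suc k) y w" using z(2) walk_Suc by blast
    then show ?thesis using gdist_le Suc by simp
  qed
qed

section \<open>Bounds for the local metric dimension\<close>

lemma local_resolving_finite: "finite {card W | W. local_resolving_set V E W}"
proof -
  have "{card W | W. local_resolving_set V E W} \<subseteq> card ` Pow V"
    unfolding local_resolving_set_def by blast
  then show ?thesis using finite_V finite_subset by blast
qed

lemma local_metric_dim_le: "local_resolving_set V E W \<Longrightarrow> local_metric_dim V E \<le> card W"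
  unfolding local_metric_dim_def using local_resolving_finite by (intro Min_le) blast+

lemma local_metric_dim_ge:
  assumes "\<And>W. local_resolving_set V E W \<Longrightarrow> k \<le> card W"
  shows "k \<le> local_metric_dim V E"
proof -
  have "local_resolving_set V E V" unfolding local_resolving_set_def by blast
  then have "Min {card W | W. local_resolving_set V E W} \<in> {card W | W. local_resolving_set V E W}"
    using local_resolving_finite by (intro Min_in) blast+
  then show ?thesis using assms unfolding local_metric_dim_def by auto
qed

lemma local_metric_dim_le_diff:
  assumes "S \<subseteq> V" "\<And>x y. x \<in> S \<Longrightarrow> y \<in> S \<Longrightarrow> E x y \<Longrightarrow> \<exists>w\<in>V - S. gdist V E x w \<noteq> gdist V E y w"
  shows "local_metric_dim V E \<le> card V - card S"
proof -
  have "V - (V - S) = S" using assms(1) by blast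
  then have "local_resolving_set V E (V - S)"
    unfolding local_resolving_set_def using assms(2) by auto
  then have "local_metric_dim V E \<le> card (V - S)" by (rule local_metric_dim_le)
  then show ?thesis using assms(1) finite_V finite_subset by (metis card_Diff_subset)
qed

lemma gdist_neqI: "x \<in> V \<Longrightarrow> y \<in> V \<Longrightarrow> w \<in> V \<Longrightarrow> E x w \<noteq> E y w \<Longrightarrow> gdist V E x w \<noteq> gdist V E y w"
  using gdist_eq_1_iff by metis

lemma good_dim:
  assumes "good V"
  shows "local_metric_dim V E \<le> card V - 4"
proof -
  obtain S where S: "S \<subseteq> V" "card S = 4" "\<forall>x\<in>S. \<forall>y\<in>S. E x y \<longrightarrow> (\<exists>w\<in>V - S. E x w \<noteq> E y w)"
    using assms unfolding good_def by blast
  have "local_metric_dim V E \<le> card V - card S"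
    using S(1)
  proof (rule local_metric_dim_le_diff)
    fix x y assume xy: "x \<in> S" "y \<in> S" "E x y"
    then obtain w where "w \<in> V - S" "E x w \<noteq> E y w" using S(3) by blast
    then show "\<exists>w\<in>V - S. gdist V E x w \<noteq> gdist V E y w"
      using gdist_neqI[of x y w] xy S(1) by blast
  qed
  then show ?thesis using S(2) by simp
qed

text \<open>One vertex of each level is left out. A second vertex \<open>b'\<close> on level 3
  separates \<open>u\<close> from \<open>a\<close> by distances 3 and 2, and \<open>a\<close> from
  \<open>c\<close> by adjacency. The spare vertex \<open>z\<close> on the two lowest levels
  separates \<open>c\<close> from \<open>b\<close>.\<close>

lemma four_chain_dim:
  assumes ch: "four_chain V l"
  shows "local_metric_dim V E \<le> card V - 4"
proof -
  have l3: "\<And>x. x \<in> V \<Longrightarrow> l x \<le> 3" and chain: "chain V l"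
    and cards: "2 \<le> card (level V l 3)" "3 \<le> card (level V l 0) + card (level V l 1)"
    using ch unfolding four_chain_def by blast+
  have adj: "E x y \<longleftrightarrow> l x \<le> Suc (l y) \<and> l y \<le> Suc (l x)" if "x \<in> V" "y \<in> V" "x \<noteq> y" for x y
    using chain that unfolding chain_def by blast
  obtain u where u: "u \<in> V" "l u = 0" using ch unfolding four_chain_def level_def by blast
  obtain a where a: "a \<in> V" "l a = 1" using ch unfolding four_chain_def level_def by blast
  obtain c where c: "c \<in> V" "l c = 2" using ch unfolding four_chain_def level_def by blast
  obtain b b' where b: "b \<in> V" "l b = 3" "b' \<in> V" "l b' = 3" "b \<noteq> b'"
    using two_elements[OF cards(1)] unfolding level_def by blast
  obtain z where z: "z \<in> V" "z \<noteq> u" "z \<noteq> a" "l z = 0 \<or> l z = 1"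
  proof (cases "2 \<le> card (level V l 1)")
    case True
    then obtain z where "z \<in> level V l 1" and za: "z \<noteq> a" by (rule other_element)
    then have "z \<in> V" "l z = 1" unfolding level_def by blast+
    then show ?thesis using za u by (intro that[of z]) auto
  next
    case False
    then have "2 \<le> card (level V l 0)" using cards(2) by linarith
    then obtain z where "z \<in> level V l 0" and zu: "z \<noteq> u" by (rule other_element)
    then have "z \<in> V" "l z = 0" unfolding level_def by blast+
    then show ?thesis using zu a by (intro that[of z]) auto
  qed
  have ne: "u \<noteq> a" "u \<noteq> c" "u \<noteq> b" "u \<noteq> b'" "a \<noteq> c" "a \<noteq> b" "a \<noteq> b'" "c \<noteq> b" "c \<noteq> b'" "z \<noteq> c" "z \<noteq> b"
    using u a c b z by auto
  have far: "gdist V E x y \<noteq> 2" if xy: "x \<in> V" "y \<in> V" "l x = 0" "l y = 3" for x y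
  proof
    assume d: "gdist V E x y = 2"
    have "x \<noteq> y" using xy by auto
    moreover have "\<not> E x y" using adj xy \<open>x \<noteq> y\<close> by simp
    ultimately obtain w where w: "E x w" "E w y" using d gdist_eq_2_iff[OF xy(1,2)] by blast
    then have "w \<in> V" "x \<noteq> w" "w \<noteq> y" using E_in_V irrefl by blast+
    then show False using adj[of x w] adj[of w y] xy w by auto
  qed
  have near: "gdist V E x y = 2" if "x \<in> V" "y \<in> V" "w \<in> V" "l y = l x + 2" "l w = l x + 1" for x y w
  proof -
    have ne: "x \<noteq> y" "x \<noteq> w" "w \<noteq> y" using that by auto
    then have "\<not> E x y" "E x w" "E w y" using adj[of x y] adj[of x w] adj[of w y] that by auto
    then show ?thesis using gdist_eq_2_iff[OF that(1,2) ne(1)] by blast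
  qed
  \<comment> \<open>Symmetry for the value 2 follows from the symmetric description by a common
    neighbour.\<close>
  have gsym: "gdist V E x y = 2 \<longleftrightarrow> gdist V E y x = 2" if "x \<in> V" "y \<in> V" for x y
  proof -
    have "gdist V E x y = 2 \<Longrightarrow> gdist V E y x = 2" if xy: "x \<in> V" "y \<in> V" for x y
    proof -
      assume d: "gdist V E x y = 2"
      have "walk 0 x x" using xy walk_0 by blast
      then have "x \<noteq> y" using d gdist_le by fastforce
      moreover have "\<not> E x y" using gdist_eq_1_iff[OF xy] d by auto
      ultimately show "gdist V E y x = 2"
        using d gdist_eq_2_iff[OF xy] gdist_eq_2_iff[OF xy(2,1)] sym by blast
    qed
    then show ?thesis using that by blast
  qed
  have W: "b' \<in> V - {u, a, c, b}" "z \<in> V - {u, a, c, b}" using b z ne by blast+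
  have ua: "gdist V E u b' \<noteq> gdist V E a b'"
    using far[of u b'] near[of a b' c] u a b c by simp
  have ac: "gdist V E a b' \<noteq> gdist V E c b'"
    by (rule gdist_neqI) (use adj[of a b'] adj[of c b'] a b c ne in auto)
  have cb: "gdist V E c z \<noteq> gdist V E b z"
    using z(4)
  proof
    assume "l z = 0"
    then have "gdist V E c z = 2" "gdist V E b z \<noteq> 2"
      using near[of z c a] far[of z b] gsym[of z c] gsym[of z b] z a b c by auto
    then show ?thesis by simp
  next
    assume "l z = 1"
    then show ?thesis
      by (intro gdist_neqI) (use adj[of c z] adj[of b z] z b c ne in auto)
  qed
  have non: "\<not> E u c" "\<not> E u b" "\<not> E a b" "\<not> E c u" "\<not> E b u" "\<not> E b a"
    using adj u a b c ne ne[symmetric] by auto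
  have "local_metric_dim V E \<le> card V - card {u, a, c, b}"
  proof (rule local_metric_dim_le_diff)
    show "{u, a, c, b} \<subseteq> V" using u a b c by blast
    show "\<exists>w\<in>V - {u, a, c, b}. gdist V E x w \<noteq> gdist V E y w"
      if "x \<in> {u, a, c, b}" "y \<in> {u, a, c, b}" "E x y" for x y
    proof -
      have "x = u \<and> y = a \<or> x = a \<and> y = u \<or> x = a \<and> y = c \<or> x = c \<and> y = a \<or> x = c \<and> y = b \<or> x = b \<and> y = c"
        using that non irrefl by auto
      then show ?thesis using ua ac cb W by metis
    qed
  qed
  then show ?thesis using ne by simp
qed

section \<open>Dimension of the extremal graphs\<close>

text \<open>The edge opposite \<open>p\<close> has both ends at distance 2 from
  \<open>p\<close>.\<close>

lemma five_cycle_not_resolving: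
  assumes "five_cycle V p q r s t" "W \<subseteq> {p}"
  shows "\<not> local_resolving_set V E W"
proof
  assume res: "local_resolving_set V E W"
  have C: "V = {p, q, r, s, t}" "distinct [p, q, r, s, t]" and
    e: "E p q" "E q r" "E r s" "E s t" "E t p" "\<not> E p r" "\<not> E p s" "\<not> E q s" "\<not> E q t" "\<not> E r t"
    using assms(1) unfolding five_cycle_def by blast+
  have ne: "r \<noteq> p" "s \<noteq> p" using C(2) by auto
  have inV: "p \<in> V" "r \<in> V" "s \<in> V" using C(1) by blast+
  have "gdist V E r p = 2"
    using gdist_eq_2_iff[OF inV(2,1) ne(1)] e sym by blast
  moreover have "gdist V E s p = 2"
    using gdist_eq_2_iff[OF inV(3,1) ne(2)] e sym by blast
  moreover have "\<exists>w\<in>W. gdist V E r w \<noteq> gdist V E s w"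
    using res inV ne e(3) assms(2) unfolding local_resolving_set_def by blast
  ultimately show False using assms(2) by auto
qed

lemma five_cycle_dim:
  assumes cyc: "five_cycle V p q r s t"
  shows "card V = 5" "local_metric_dim V E = 2"
proof -
  have C: "V = {p, q, r, s, t}" "distinct [p, q, r, s, t]" and
    e: "E p q" "E q r" "E r s" "E s t" "E t p" "\<not> E p r" "\<not> E p s" "\<not> E q s" "\<not> E q t" "\<not> E r t"
    using cyc unfolding five_cycle_def by blast+
  show c5: "card V = 5" unfolding C(1) using C(2) by simp
  have inV: "p \<in> V" "q \<in> V" "r \<in> V" "s \<in> V" "t \<in> V" using C(1) by blast+
  have W: "p \<in> V - {r, s, t}" "q \<in> V - {r, s, t}" using C(2) inV by auto
  have rs: "gdist V E r q \<noteq> gdist V E s q"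
    by (rule gdist_neqI[OF inV(3,4,2)]) (use e sym in blast)
  have st: "gdist V E s p \<noteq> gdist V E t p"
    by (rule gdist_neqI[OF inV(4,5,1)]) (use e sym in blast)
  have "local_metric_dim V E \<le> card V - card {r, s, t}"
  proof (rule local_metric_dim_le_diff)
    show "{r, s, t} \<subseteq> V" using inV by blast
    show "\<exists>w\<in>V - {r, s, t}. gdist V E x w \<noteq> gdist V E y w"
      if "x \<in> {r, s, t}" "y \<in> {r, s, t}" "E x y" for x y
    proof -
      have "x = r \<and> y = s \<or> x = s \<and> y = r \<or> x = s \<and> y = t \<or> x = t \<and> y = s"
        using that irrefl e(10) sym by blast
      then show ?thesis using rs st W by metis
    qed
  qed
  then have le: "local_metric_dim V E \<le> 2" using c5 C(2) by simp
  have "2 \<le> local_metric_dim V E"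
  proof (rule local_metric_dim_ge)
    fix W assume res: "local_resolving_set V E W"
    show "2 \<le> card W"
    proof (rule ccontr)
      assume "\<not> 2 \<le> card W"
      have WV: "W \<subseteq> V" using res unfolding local_resolving_set_def by blast
      \<comment> \<open>Covering \<open>W\<close> by a singleton treats the empty set too; a
        rotation then moves \<open>w\<close> to the first position.\<close>
      have "\<exists>w\<in>V. W \<subseteq> {w}"
      proof (cases "W = {}")
        case True
        then show ?thesis using inV by blast
      next
        case False
        then obtain w where "w \<in> W" by blast
        moreover have "W = {w}"
          using \<open>w \<in> W\<close> \<open>\<not> 2 \<le> card W\<close> finite_subset[OF WV finite_V] by (intro singleton_if_small)
        ultimately show ?thesis using WV by blast
      qed
      then obtain w where w: "w \<in> V" "W \<subseteq> {w}" by blast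
      note r1 = five_cycle_rotate[OF cyc]
      note r2 = five_cycle_rotate[OF r1]
      note r3 = five_cycle_rotate[OF r2]
      note r4 = five_cycle_rotate[OF r3]
      have "w = p \<or> w = q \<or> w = r \<or> w = s \<or> w = t" using w(1) C(1) by blast
      then show False
        using res w(2) five_cycle_not_resolving[OF cyc, of W] five_cycle_not_resolving[OF r1, of W]
          five_cycle_not_resolving[OF r2, of W] five_cycle_not_resolving[OF r3, of W]
          five_cycle_not_resolving[OF r4, of W]
        by (elim disjE) simp_all
    qed
  qed
  then show "local_metric_dim V E = 2" using le by linarith
qed

text \<open>For the upper bound one vertex per level is left out, and the spare vertices
  \<open>a'\<close> and \<open>b'\<close> on the outer levels separate. For the lower bound,
  vertices of one level are true twins, which no third vertex distinguishes, so a local resolving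
  set misses at most one of them.\<close>

lemma three_levels_dim:
  assumes chain: "chain V l" and l2: "\<And>x. x \<in> V \<Longrightarrow> l x \<le> 2" and l1: "level V l 1 \<noteq> {}"
    and cards: "2 \<le> card (level V l 0)" "2 \<le> card (level V l 2)"
  shows "local_metric_dim V E = card V - 3"
proof -
  have adj: "E x y \<longleftrightarrow> l x \<le> Suc (l y) \<and> l y \<le> Suc (l x)" if "x \<in> V" "y \<in> V" "x \<noteq> y" for x y
    using chain that unfolding chain_def by blast
  obtain c where c: "c \<in> V" "l c = 1" using l1 unfolding level_def by blast
  obtain a a' where a: "a \<in> V" "l a = 0" "a' \<in> V" "l a' = 0" "a \<noteq> a'"
    using two_elements[OF cards(1)] unfolding level_def by blast
  obtain b b' where b: "b \<in> V" "l b = 2" "b' \<in> V" "l b' = 2" "b \<noteq> b'"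
    using two_elements[OF cards(2)] unfolding level_def by blast
  have ne: "a \<noteq> c" "a \<noteq> b" "c \<noteq> b" "a' \<noteq> c" "a' \<noteq> b" "a \<noteq> b'" "c \<noteq> b'" using a b c by auto
  have W: "a' \<in> V - {a, c, b}" "b' \<in> V - {a, c, b}" using a b ne by blast+
  have ac: "gdist V E a b' \<noteq> gdist V E c b'"
    by (rule gdist_neqI) (use adj[of a b'] adj[of c b'] a b c ne in auto)
  have cb: "gdist V E c a' \<noteq> gdist V E b a'"
    by (rule gdist_neqI) (use adj[of c a'] adj[of b a'] a b c ne in auto)
  have nab: "\<not> E a b" using adj[of a b] a b ne by simp
  have "local_metric_dim V E \<le> card V - card {a, c, b}"
  proof (rule local_metric_dim_le_diff)
    show "{a, c, b} \<subseteq> V" using a b c by blast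
    show "\<exists>w\<in>V - {a, c, b}. gdist V E x w \<noteq> gdist V E y w"
      if "x \<in> {a, c, b}" "y \<in> {a, c, b}" "E x y" for x y
    proof -
      have "x = a \<and> y = c \<or> x = c \<and> y = a \<or> x = c \<and> y = b \<or> x = b \<and> y = c"
        using that irrefl nab sym by blast
      then show ?thesis using ac cb W by metis
    qed
  qed
  then have le: "local_metric_dim V E \<le> card V - 3" using ne by simp
  have "card V - 3 \<le> local_metric_dim V E"
  proof (rule local_metric_dim_ge)
    fix W assume res: "local_resolving_set V E W"
    have WV: "W \<subseteq> V" using res unfolding local_resolving_set_def by blast
    \<comment> \<open>Missing at most one vertex per level means that the labelling is injective on
      the complement of \<open>W\<close>, with only three possible values.\<close>
    have "inj_on l (V - W)"
    proof (rule inj_onI, rule ccontr)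
      fix x y assume xy: "x \<in> V - W" "y \<in> V - W" "l x = l y" "x \<noteq> y"
      have xyV: "x \<in> V" "y \<in> V" using xy by blast+
      have "E x y" using adj[OF xyV xy(4)] xy(3) by simp
      then obtain w where w: "w \<in> W" "gdist V E x w \<noteq> gdist V E y w"
        using res xy unfolding local_resolving_set_def by blast
      have tw: "E x z = E y z" if "z \<in> V" "z \<noteq> x" "z \<noteq> y" for z
        using adj[of x z] adj[of y z] that xyV xy(3) by auto
      have wne: "w \<noteq> x" "w \<noteq> y" "w \<in> V" using w xy WV by blast+
      have "gdist V E y w \<le> gdist V E x w"
        by (rule gdist_twins_le[OF xyV(1) wne(3,1) tw])
      moreover have "gdist V E x w \<le> gdist V E y w"
        by (rule gdist_twins_le[OF xyV(2) wne(3,2) tw[symmetric]])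
      ultimately show False using w(2) by linarith
    qed
    moreover have "l ` (V - W) \<subseteq> {..2}" using l2 by auto
    ultimately have "card (V - W) \<le> card {..2::nat}" by (intro card_inj_on_le) auto
    then show "card V - 3 \<le> card W"
      using card_Diff_subset[of W V] WV finite_subset[OF WV finite_V] by simp
  qed
  then show ?thesis using le by linarith
qed

section \<open>Isomorphisms with the named graphs\<close>

lemma five_cycle_iso:
  assumes "five_cycle V p q r s t"
  shows "graph_iso V E C5_V C5_E"
proof -
  have C: "V = {p, q, r, s, t}" "distinct [p, q, r, s, t]" and
    e: "E p q" "E q r" "E r s" "E s t" "E t p" "\<not> E p r" "\<not> E p s" "\<not> E q s" "\<not> E q t" "\<not> E r t"
    using assms unfolding five_cycle_def by blast+
  have e': "E q p" "E r q" "E s r" "E t s" "E p t" "\<not> E r p" "\<not> E s p" "\<not> E s q" "\<not> E t q" "\<not> E t r"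
    using e sym by blast+
  define f where "f = (\<lambda>x. if x = p then 0 else if x = q then 1 else if x = r then 2 else if x = s then 3 else 4 :: nat)"
  have f: "f p = 0" "f q = 1" "f r = 2" "f s = 3" "f t = 4" using C(2) unfolding f_def by auto
  have "inj_on f V" unfolding C(1) using f by (simp add: inj_on_def)
  moreover have "f ` V = C5_V" unfolding C(1) C5_V_def using f by auto
  ultimately have "bij_betw f V C5_V" unfolding bij_betw_def by blast
  moreover have "\<forall>x\<in>V. \<forall>y\<in>V. E x y \<longleftrightarrow> C5_E (f x) (f y)"
    unfolding C(1) by (simp add: f e e' irrefl C5_E_def)
  ultimately show ?thesis unfolding graph_iso_def by blast
qed

lemma iso_five_cycle:
  assumes "graph_iso V E C5_V C5_E"
  shows "\<exists>p q r s t. five_cycle V p q r s t"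
proof -
  obtain f where f: "bij_betw f V C5_V" and e: "\<And>x y. x \<in> V \<Longrightarrow> y \<in> V \<Longrightarrow> E x y \<longleftrightarrow> C5_E (f x) (f y)"
    using assms unfolding graph_iso_def by blast
  have img: "f ` V = C5_V" using f unfolding bij_betw_def by blast
  have "\<exists>x\<in>V. f x = i" if "i < 5" for i
  proof -
    have "i \<in> f ` V" unfolding img C5_V_def using that by simp
    then show ?thesis by blast
  qed
  then obtain g where g: "\<And>i. i < 5 \<Longrightarrow> g i \<in> V \<and> f (g i) = i" by metis
  have gV: "g 0 \<in> V" "g 1 \<in> V" "g 2 \<in> V" "g 3 \<in> V" "g 4 \<in> V" using g by simp_all
  have fg: "f (g 0) = 0" "f (g 1) = 1" "f (g 2) = 2" "f (g 3) = 3" "f (g 4) = 4" using g by simp_all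
  have "V \<subseteq> {g 0, g 1, g 2, g 3, g 4}"
  proof
    fix x assume x: "x \<in> V"
    then have "f x \<in> C5_V" using img by blast
    then have "f x < 5" unfolding C5_V_def by simp
    then have "g (f x) = x" using g[of "f x"] f x unfolding bij_betw_def inj_on_def by blast
    moreover have "f x = 0 \<or> f x = 1 \<or> f x = 2 \<or> f x = 3 \<or> f x = 4" using \<open>f x < 5\<close> by linarith
    ultimately show "x \<in> {g 0, g 1, g 2, g 3, g 4}" by (metis insertCI)
  qed
  then have VV: "V = {g 0, g 1, g 2, g 3, g 4}" using gV by blast
  have d: "distinct [g 0, g 1, g 2, g 3, g 4]"
  proof -
    have "distinct (map f [g 0, g 1, g 2, g 3, g 4])" by (simp add: fg del: One_nat_def)
    then show ?thesis unfolding distinct_map by blast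
  qed
  have "five_cycle V (g 0) (g 1) (g 2) (g 3) (g 4)"
    unfolding five_cycle_def
  proof (intro conjI)
    show "V = {g 0, g 1, g 2, g 3, g 4}" by (rule VV)
    show "distinct [g 0, g 1, g 2, g 3, g 4]" by (rule d)
  qed (simp_all add: e gV fg C5_E_def del: One_nat_def)
  then show ?thesis by blast
qed

lemma three_chain_iso:
  assumes ch: "three_chain V l" and le: "card (level V l 2) \<le> card (level V l 0)"
  shows "\<exists>k m. k \<ge> m \<and> m \<ge> 2 \<and> k + m < card V \<and> graph_iso V E (Kminus_V (card V)) (Kminus_E (card V) k m)"
proof -
  have chain: "chain V l" and l2: "\<And>x. x \<in> V \<Longrightarrow> l x \<le> 2" and l1: "level V l 1 \<noteq> {}"
    and cards: "3 \<le> card (level V l 0)" "3 \<le> card (level V l 2)"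
    using ch unfolding three_chain_def by blast+
  have adj: "E x y \<longleftrightarrow> l x \<le> Suc (l y) \<and> l y \<le> Suc (l x)" if "x \<in> V" "y \<in> V" "x \<noteq> y" for x y
    using chain that unfolding chain_def by blast
  define k m c where "k = card (level V l 0)" and "m = card (level V l 2)" and "c = card (level V l 1)"
  have fin: "finite (level V l i)" for i unfolding level_def using finite_V by simp
  have VL: "V = level V l 0 \<union> level V l 2 \<union> level V l 1"
  proof -
    have "l x = 0 \<or> l x = 2 \<or> l x = 1" if "x \<in> V" for x using l2[OF that] by linarith
    then show ?thesis unfolding level_def by blast
  qed
  \<comment> \<open>The levels are numbered in the order 0, 2, 1, since the two parts of the deleted
    complete bipartite graph occupy the first \<open>k + m\<close> numbers.\<close>
  obtain f0 where f0: "bij_betw f0 (level V l 0) {0..<0 + k}" unfolding k_def by (rule obtain_shifted_bij[OF fin])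
  obtain f2 where f2: "bij_betw f2 (level V l 2) {k..<k + m}" unfolding m_def by (rule obtain_shifted_bij[OF fin])
  obtain f1 where f1: "bij_betw f1 (level V l 1) {k + m..<k + m + c}" unfolding c_def by (rule obtain_shifted_bij[OF fin])
  define f where "f = (\<lambda>x. if l x = 0 then f0 x else if l x = 2 then f2 x else f1 x)"
  have g0: "bij_betw f (level V l 0) {0..<k}"
    using f0 by (subst bij_betw_cong[of _ _ f0]) (auto simp: f_def level_def)
  have g2: "bij_betw f (level V l 2) {k..<k + m}"
    using f2 by (subst bij_betw_cong[of _ _ f2]) (auto simp: f_def level_def)
  have g1: "bij_betw f (level V l 1) {k + m..<k + m + c}"
    using f1 by (subst bij_betw_cong[of _ _ f1]) (auto simp: f_def level_def)
  have "bij_betw f (level V l 0 \<union> level V l 2 \<union> level V l 1) ({0..<k} \<union> {k..<k + m} \<union> {k + m..<k + m + c})"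
    by (intro bij_betw_combine g0 g1 g2) auto
  moreover have "{0..<k} \<union> {k..<k + m} \<union> {k + m..<k + m + c} = {0..<k + m + c}" by auto
  ultimately have bij: "bij_betw f V {0..<k + m + c}" using VL by simp
  then have n: "card V = k + m + c" using bij_betw_same_card by fastforce
  have c0: "0 < c" unfolding c_def using l1 fin by (simp add: card_gt_0_iff)
  have r0: "f x < k" if "x \<in> V" "l x = 0" for x
    using bij_betw_apply[OF g0, of x] that unfolding level_def by simp
  have r2: "k \<le> f x \<and> f x < k + m" if "x \<in> V" "l x = 2" for x
    using bij_betw_apply[OF g2, of x] that unfolding level_def by simp
  have r1: "k + m \<le> f x" if "x \<in> V" "l x = 1" for x
    using bij_betw_apply[OF g1, of x] that unfolding level_def by simp
  have rn: "f x < k + m + c" if "x \<in> V" for x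
    using bij_betw_apply[OF bij that] by simp
  have lev: "(f x < k \<longleftrightarrow> l x = 0) \<and> (k \<le> f x \<and> f x < k + m \<longleftrightarrow> l x = 2)" if "x \<in> V" for x
  proof -
    consider "l x = 0" | "l x = 1" | "l x = 2" using l2[OF \<open>x \<in> V\<close>] by linarith
    then show ?thesis
      by cases (use r0[OF that] r1[OF that] r2[OF that] in auto)
  qed
  have "E x y \<longleftrightarrow> Kminus_E (card V) k m (f x) (f y)" if xy: "x \<in> V" "y \<in> V" for x y
  proof (cases "x = y")
    case True
    then show ?thesis using irrefl unfolding Kminus_E_def by simp
  next
    case False
    then have "f x \<noteq> f y" using bij xy unfolding bij_betw_def inj_on_def by blast
    then have "Kminus_E (card V) k m (f x) (f y) \<longleftrightarrow> \<not> (l x = 0 \<and> l y = 2 \<or> l y = 0 \<and> l x = 2)"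
      unfolding Kminus_E_def n using rn[OF xy(1)] rn[OF xy(2)] lev[OF xy(1)] lev[OF xy(2)] by simp
    moreover have "E x y \<longleftrightarrow> \<not> (l x = 0 \<and> l y = 2 \<or> l y = 0 \<and> l x = 2)"
      using adj[OF xy False] l2[OF xy(1)] l2[OF xy(2)] by auto
    ultimately show ?thesis by blast
  qed
  moreover have "bij_betw f V (Kminus_V (card V))" using bij unfolding Kminus_V_def n .
  ultimately have "graph_iso V E (Kminus_V (card V)) (Kminus_E (card V) k m)"
    unfolding graph_iso_def by blast
  then show ?thesis
    using le cards n c0 unfolding k_def[symmetric] m_def[symmetric] by (intro exI[of _ k] exI[of _ m]) auto
qed

text \<open>Reversing the labelling swaps the outer levels, so the larger one may be taken as level
  0.\<close>

lemma three_chain_iso_Kminus: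
  assumes "three_chain V l"
  shows "\<exists>k m. k \<ge> m \<and> m \<ge> 2 \<and> k + m < card V \<and> graph_iso V E (Kminus_V (card V)) (Kminus_E (card V) k m)"
proof (cases "card (level V l 2) \<le> card (level V l 0)")
  case True
  then show ?thesis using three_chain_iso[OF assms] by blast
next
  case False
  have l2: "\<And>x. x \<in> V \<Longrightarrow> l x \<le> 2" using assms unfolding three_chain_def by blast
  have "level V (\<lambda>x. 2 - l x) 2 = level V l 0" "level V (\<lambda>x. 2 - l x) 0 = level V l 2"
    using l2 unfolding level_def by force+
  then show ?thesis using three_chain_iso[OF three_chain_reverse[OF assms]] False by simp
qed

lemma iso_Kminus_dim:
  assumes iso: "graph_iso V E (Kminus_V (card V)) (Kminus_E (card V) k m)"
    and km: "2 \<le> k" "2 \<le> m" "k + m < card V"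
  shows "local_metric_dim V E = card V - 3"
proof -
  obtain f where f: "bij_betw f V {0..<card V}"
    and e: "\<And>x y. x \<in> V \<Longrightarrow> y \<in> V \<Longrightarrow> E x y \<longleftrightarrow> Kminus_E (card V) k m (f x) (f y)"
    using iso unfolding graph_iso_def Kminus_V_def by blast
  \<comment> \<open>The vertices outside both deleted parts are adjacent to everything and form the
    middle level.\<close>
  define l where "l = (\<lambda>x. if f x < k then 0 else if f x < k + m then 2 else 1 :: nat)"
  have L: "level V l 0 = {x \<in> V. f x \<in> {0..<k}}" "level V l 2 = {x \<in> V. f x \<in> {k..<k + m}}"
    "level V l 1 = {x \<in> V. f x \<in> {k + m..<card V}}"
    using bij_betw_apply[OF f] unfolding level_def l_def by auto
  have sub: "{0..<k} \<subseteq> {0..<card V}" "{k..<k + m} \<subseteq> {0..<card V}" "{k + m..<card V} \<subseteq> {0..<card V}"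
    using km(3) by auto
  have c: "card (level V l 0) = k" "card (level V l 2) = m" "card (level V l 1) = card V - (k + m)"
    unfolding L sub[THEN card_bij_preimage[OF f]] by simp_all
  show ?thesis
  proof (rule three_levels_dim)
    show "chain V l"
      unfolding chain_def
    proof (intro ballI impI)
      fix x y assume xy: "x \<in> V" "y \<in> V" "x \<noteq> y"
      then have "f x \<noteq> f y" using f unfolding bij_betw_def inj_on_def by blast
      moreover have "f x < card V" "f y < card V" using bij_betw_apply[OF f] xy by auto
      ultimately show "E x y \<longleftrightarrow> l x \<le> Suc (l y) \<and> l y \<le> Suc (l x)"
        unfolding e[OF xy(1,2)] Kminus_E_def l_def by auto
    qed
    have "card (level V l 1) \<noteq> 0" using c km by simp
    then show "level V l 1 \<noteq> {}" by auto
  qed (use c km in \<open>simp_all add: l_def\<close>)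
qed

section \<open>Clique number and conclusion\<close>

lemma clique_card_le:
  assumes "is_clique V E K"
  shows "card K \<le> clique_number V E"
proof -
  have "{card K | K. is_clique V E K} \<subseteq> card ` Pow V" unfolding is_clique_def by blast
  then have "finite {card K | K. is_clique V E K}" using finite_V finite_subset by blast
  then show ?thesis unfolding clique_number_def using assms by (intro Max_ge) blast+
qed

end

theorem theorem2p2:
  fixes V :: "'a set" and E :: "'a \<Rightarrow> 'a \<Rightarrow> bool"
  assumes "simple_graph V E" and "connected_graph V E"
    and "card V \<ge> 5" and "clique_number V E \<le> card V - 3"
  shows "local_metric_dim V E \<le> card V - 3 \<and>
    (local_metric_dim V E = card V - 3 \<longleftrightarrow>
      (graph_iso V E C5_V C5_E \<or>
       (\<exists>l m. l \<ge> m \<and> m \<ge> 2 \<and> l + m < card V \<and>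
              graph_iso V E (Kminus_V (card V)) (Kminus_E (card V) l m))))"
proof -
  interpret connected_simple_graph V E using assms(1,2) by unfold_locales
  let ?iso = "graph_iso V E C5_V C5_E \<or>
       (\<exists>l m. l \<ge> m \<and> m \<ge> 2 \<and> l + m < card V \<and>
              graph_iso V E (Kminus_V (card V)) (Kminus_E (card V) l m))"
  have iso_dim: "local_metric_dim V E = card V - 3" if iso: ?iso
    using iso
  proof
    assume "graph_iso V E C5_V C5_E"
    then obtain p q r s t where "five_cycle V p q r s t" using iso_five_cycle by blast
    then show ?thesis using five_cycle_dim by simp
  next
    assume "\<exists>l m. l \<ge> m \<and> m \<ge> 2 \<and> l + m < card V \<and>
              graph_iso V E (Kminus_V (card V)) (Kminus_E (card V) l m)"
    then obtain l m where lm: "l \<ge> m" "m \<ge> 2" "l + m < card V"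
      "graph_iso V E (Kminus_V (card V)) (Kminus_E (card V) l m)" by blast
    show ?thesis by (rule iso_Kminus_dim[OF lm(4)]) (use lm in linarith)+
  qed
  have "card M \<le> card V - 3" if "is_clique V E M" for M
    using clique_card_le[OF that] assms(4) by linarith
  then have "good V \<or> (\<exists>p q r s t. five_cycle V p q r s t) \<or> (\<exists>l. three_chain V l) \<or> (\<exists>l. four_chain V l)"
    by (rule classification[OF finite_V linked_V assms(3)])
  then have dim: "local_metric_dim V E \<le> card V - 4 \<or> ?iso"
    using good_dim four_chain_dim five_cycle_iso three_chain_iso_Kminus by blast
  \<comment> \<open>With \<open>n \<ge> 5\<close> the truncated differences satisfy
    \<open>n - 4 < n - 3\<close>, so dimension at most \<open>n - 4\<close> excludes
    equality.\<close>
  have "d \<le> n - 3 \<and> (d = n - 3 \<longleftrightarrow> I)" if "d \<le> n - 4 \<or> I" "I \<Longrightarrow> d = n - 3" "5 \<le> n" for d n :: nat and I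
    using that by (cases I) auto
  from this[OF dim iso_dim assms(3)] show ?thesis .
qed

end
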